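(* Let $n>2$ be an integer and let $m/n\in(0,1)$ be an irreducible fraction (i.e. $0<m<n$, $\gcd(m,n)=1$). Let $\psi_{m/n}(x)$ be the minimal polynomial of $2\cos(m\pi/n)$ over $\mathbb{Q}$. (i) If both $n$ and $m$ are odd, then $$\psi_{m/n}(x)=\psi_{1/n}(x)=\psi_{2n}(x)=\frac{p^-_{\lfloor n/2\rfloor}(x)}{\prod_{2<d<n,\ d\mid n}\psi_{2n/d}(x)} =p^-_{\lfloor n/2\rfloor}(x)\cdot\prod_{i=1}^{\#\Pi_1(n)}\left(\prod_{d\in\Pi_i(n)}p^-_{\lfloor n/(2d)\rfloor}(x)\right)^{(-1)^i}.$$ In particular, if $n=p^\ell$ for an odd prime $p$, then $\psi_{m/n}(x)=\psi_{1/n}(x)=\psi_{2n}(x)$ equals $p^-_{\lfloor n/2\rfloor}(x)$ if $\ell=1$, and equals $p^-_{\lfloor n/2\rfloor}(x)/p^-_{\lfloor n/(2p)\rfloor}(x)$ if $\ell>1$. (ii) If $n$ is odd and $m$ is even, then $$\psi_{m/n}(x)=\psi_{2/n}(x)=\psi_{n}(x)=\frac{p^+_{\lfloor n/2\rfloor}(x)}{\prod_{2<d<n,\ d\mid n}\psi_{n/d}(x)} =p^+_{\lfloor n/2\rfloor}(x)\cdot\prod_{i=1}^{\#\Pi_1(n)}\left(\prod_{d\in\Pi_i(n)}p^+_{\lfloor n/(2d)\rfloor}(x)\right)^{(-1)^i}.$$ In particular, if $n=p^\ell$ for an odd prime $p$, then $\psi_{m/n}(x)=\psi_{2/n}(x)=\psi_{n}(x)$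 equals $p^+_{\lfloor n/2\rfloor}(x)$ if $\ell=1$, and equals $p^+_{\lfloor n/2\rfloor}(x)/p^+_{\lfloor n/(2p)\rfloor}(x)$ if $\ell>1$. (iii) If $n=2^jn'$ is even with $j>0$ and $n'$ odd, and $m$ is odd, then $$\psi_{m/n}(x)=\psi_{1/n}(x)=\psi_{2n}(x)=\frac{q^-_{n/2}(x)}{\prod_{2<d\leqslant n',\ d\mid n'}\psi_{2n/d}(x)} =q^-_{n/2}(x)\cdot\prod_{i=1}^{\#\Pi_1(n)}\left(\prod_{d\in\Pi_i(n)}q^-_{n/(2d)}(x)\right)^{(-1)^i}.$$ In particular, if $n=2^jp^\ell$ for an odd prime $p$ (with $\ell\geqslant 0$), then $\psi_{m/n}(x)=\psi_{1/n}(x)=\psi_{2n}(x)$ equals $q^-_{n/2}(x)$ if $\ell=0$, and equals $q^-_{n/2}(x)/q^-_{n/(2p)}(x)$ if $\ell>0$.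
   Context: Minimal polynomials are monic and taken over $\mathbb{Q}$. For a positive integer $N$, $\psi_N(x)$ denotes the minimal polynomial of $2\cos(2\pi/N)$ (this applies to integer subscripts such as $n$, $2n$, $n/d$, $2n/d$ with $d\mid n$). For an irreducible fraction $a/b\in(0,1)$, $\psi_{a/b}(x)$ denotes the minimal polynomial of $2\cos(a\pi/b)$. The polynomials $c_n(x)\in\mathbb{Z}[x]$, $n\geqslant -2$, are defined by $c_{-2}(x)=-1$, $c_{-1}(x)=0$, $c_0(x)=1$, $c_1(x)=x$ and $c_n(x)=x\,c_{n-1}(x)-c_{n-2}(x)$ for $n\geqslant 2$. For $n\geqslant 0$ put $p^\pm_n(x)=c_n(x)\pm c_{n-1}(x)$ and $q^\pm_n(x)=c_n(x)\pm c_{n-2}(x)$ (corresponding signs). For $i\geqslant 1$, $\Pi_i(n)$ is the set of all products $p_1\cdots p_i$ with $p_1\cdots p_i<n$, where $p_1,\dots,p_i$ are distinct odd prime divisors of $n$ (so $\Pi_i(n)$ may be empty; e.g. $\Pi_1(n)=\emptyset$ if $n$ is an odd prime). Empty products equal $1$. Quotients and negative powers are taken in the field of rational functions $\mathbb{Q}(x)$. *)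

theory Defs
  imports Complex_Main "HOL-Computational_Algebra.Computational_Algebra"
begin

definition is_min_poly :: "real \<Rightarrow> rat poly \<Rightarrow> bool" where
  "is_min_poly a p \<longleftrightarrow>
     lead_coeff p = 1 \<and> poly (map_poly of_rat p) a = 0 \<and>
     (\<forall>q. q \<noteq> 0 \<and> poly (map_poly of_rat q) a = 0 \<longrightarrow> degree p \<le> degree q)"

text \<open>Meaningful only for algebraic numbers; for these it is well-defined by the following lemma.\<close>

definition min_poly :: "real \<Rightarrow> rat poly" where
  "min_poly a = (THE p. is_min_poly a p)"

lemma is_min_poly_ex1:
  assumes "q \<noteq> 0" and "poly (map_poly of_rat q) (a::real) = 0"
  shows "\<exists>!p. is_min_poly a p"
proof -
  let ?R = "\<lambda>q. q \<noteq> 0 \<and> poly (map_poly of_rat q) a = 0"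
  obtain r where r: "?R r" and least: "\<And>s. ?R s \<Longrightarrow> degree r \<le> degree s"
    using assms exists_least_iff[of "\<lambda>k. \<exists>s. ?R s \<and> degree s = k"]
    by (metis linorder_not_less)
  let ?p = "smult (inverse (lead_coeff r)) r"
  have hom: "map_poly of_rat (smult c s) = smult (of_rat c) (map_poly of_rat s :: real poly)" for c s
    by (rule poly_eqI) (simp add: coeff_map_poly of_rat_mult)
  have p: "is_min_poly a ?p"
    using r least by (auto simp: is_min_poly_def hom)
  have "s = t" if st: "is_min_poly a s" "is_min_poly a t" for s t
  proof (rule ccontr)
    assume ne: "s \<noteq> t"
    have s: "lead_coeff s = 1" "s \<noteq> 0" "poly (map_poly of_rat s) a = 0"
      and t: "lead_coeff t = 1" "t \<noteq> 0" "poly (map_poly of_rat t) a = 0"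
      using st by (auto simp: is_min_poly_def)
    have deg: "degree s = degree t"
      using st s t by (auto simp: is_min_poly_def intro: antisym)
    have "map_poly of_rat (s - t) = (map_poly of_rat s - map_poly of_rat t :: real poly)"
      by (rule poly_eqI) (simp add: coeff_map_poly of_rat_diff)
    hence "?R (s - t)" using ne s t by simp
    hence le: "degree s \<le> degree (s - t)" using st by (auto simp: is_min_poly_def)
    have "degree (s - t) \<le> degree s" using deg by (simp add: degree_diff_le)
    hence "coeff (s - t) (degree (s - t)) = 0" using le deg s t by simp
    hence "s - t = 0" by (simp only: leading_coeff_0_iff)
    thus False using ne by simp
  qed
  with p show ?thesis by blast
qed

definition psi :: "nat \<Rightarrow> rat poly" where
  "psi N = min_poly (2 * cos (2 * pi / real N))"

text \<open>\<open>psi_frac a b\<close> is \<open>\<psi>\<close> with subscript the fraction \<open>a/b\<close>.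
  Note the angle \<open>a \<pi> / b\<close>, as opposed to \<open>2 \<pi> / N\<close> in \<^const>\<open>psi\<close>.\<close>

definition psi_frac :: "nat \<Rightarrow> nat \<Rightarrow> rat poly" where
  "psi_frac a b = min_poly (2 * cos (real a * pi / real b))"

text \<open>Only indices \<open>n \<ge> - 2\<close> are meaningful.\<close>

function c_poly :: "int \<Rightarrow> int poly" where
  "c_poly n =
     (if n \<le> - 2 then - 1
      else if n = - 1 then 0
      else if n = 0 then 1
      else if n = 1 then [:0, 1:]
      else [:0, 1:] * c_poly (n - 1) - c_poly (n - 2))"
  by pat_completeness auto
termination by (relation "measure (\<lambda>n. nat (n + 2))") auto

declare c_poly.simps [simp del]

definition p_minus :: "nat \<Rightarrow> int poly" where
  "p_minus n = c_poly (int n) - c_poly (int n - 1)"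

definition p_plus :: "nat \<Rightarrow> int poly" where
  "p_plus n = c_poly (int n) + c_poly (int n - 1)"

definition q_minus :: "nat \<Rightarrow> int poly" where
  "q_minus n = c_poly (int n) - c_poly (int n - 2)"

definition Pi_set :: "nat \<Rightarrow> nat \<Rightarrow> nat set" where
  "Pi_set i n =
     {\<Prod>P | P. P \<subseteq> {p. prime p \<and> odd p \<and> p dvd n} \<and> card P = i \<and> \<Prod>P < n}"

text \<open>The embedding of \<open>\<int>[x]\<close> into the field \<open>\<rat>(x)\<close>;
  elements of \<open>\<rat>[x]\<close> are embedded by \<^const>\<open>to_fract\<close>.\<close>

definition int_to_ratfun :: "int poly \<Rightarrow> rat poly fract" where
  "int_to_ratfun p = to_fract (map_poly rat_of_int p)"

end

theory Submission
  imports Defs "HOL-Number_Theory.Cong" "HOL-Computational_Algebra.Field_as_Ring"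
begin

text \<open>
  Put \<open>x = 2 cos t\<close>. Up to the factors \<open>cos (t/2)\<close> and \<open>sin (t/2)\<close>, the polynomials \<open>p_minus k\<close> and
  \<open>p_plus k\<close> are \<open>cos ((2k+1)t/2)\<close> and \<open>sin ((2k+1)t/2)\<close>, while \<open>q_minus k\<close> is \<open>2 cos (kt)\<close>. Their
  roots can therefore be read off: they are simple and of the form \<open>2 cos (a\<pi>/n)\<close>, where \<open>a\<close> runs
  through all odd numbers below \<open>n\<close> (for \<open>p_minus (n div 2)\<close> with \<open>n\<close> odd and \<open>q_minus (n div 2)\<close> with \<open>n\<close> even) or
  through all positive even numbers below \<open>n\<close> (for \<open>p_plus (n div 2)\<close> with \<open>n\<close> odd).

  The arithmetic input is that all \<open>2 cos (2\<pi>k/N)\<close> with \<open>k\<close> coprime to \<open>N\<close> are conjugate over \<open>\<rat>\<close>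
  (\<open>annihilator_two_cos_iff\<close>). It rests on the irreducibility argument for cyclotomic polynomials, in the
  form that an integer polynomial vanishing at a root of unity \<open>z\<close> of order dividing \<open>N\<close> also vanishes at
  \<open>z\<^sup>p\<close> for every prime \<open>p\<close> not dividing \<open>N\<close> (\<open>annihilator_prime_power_root_of_unity\<close>). Conjugacy gives
  \<open>psi_frac m n = psi (2 * n)\<close> for odd \<open>m\<close> and \<open>psi_frac m n = psi n\<close> for even \<open>m\<close>.

  Grouping the roots \<open>2 cos (a\<pi>/n)\<close> by \<open>gcd a n\<close> now factors each of the three polynomials into distinct
  \<open>psi\<close> (\<open>prod_psi_eqI\<close>), one for every odd \<open>d\<close> with \<open>d dvd n\<close> and \<open>d < n\<close>. Splitting off \<open>d = 1\<close> gives the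
  quotient formula. The alternating product is Moebius inversion of these factorizations, that is,
  inclusion-exclusion over the odd primes dividing \<open>n\<close> (\<open>prod_inclusion_exclusion\<close>), followed by sorting
  the sets of primes by size (\<open>prod_Pow_odd_primes\<close>). The prime power cases are those with at most one
  odd prime.
\<close>

section \<open>Evaluating a polynomial after mapping its coefficients\<close>

locale eval_hom =
  fixes h :: "'a::comm_ring_1 \<Rightarrow> 'b::comm_ring_1"
  assumes hom_1 [simp]: "h 1 = 1"
    and hom_add: "h (a + b) = h a + h b"
    and hom_mult: "h (a * b) = h a * h b"
begin

lemma hom_0 [simp]: "h 0 = 0"
  using hom_add[of 0 0] by simp

lemma eval_pCons [simp]: "poly (map_poly h (pCons a p)) x = h a + x * poly (map_poly h p) x"
  by (simp add: map_poly_pCons)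

lemma eval_monom [simp]: "poly (map_poly h (monom a n)) x = h a * x ^ n"
  by (simp add: map_poly_monom poly_monom)

lemma eval_add [simp]:
  "poly (map_poly h (p + q)) x = poly (map_poly h p) x + poly (map_poly h q) x"
  by (simp add: hom_add coeff_map_poly poly_eqI[of "map_poly h (p + q)" "map_poly h p + map_poly h q"])

lemma eval_diff [simp]:
  "poly (map_poly h (p - q)) x = poly (map_poly h p) x - poly (map_poly h q) x"
  using eval_add[of "p - q" q] by simp

lemma eval_smult [simp]: "poly (map_poly h (smult a p)) x = h a * poly (map_poly h p) x"
  by (simp add: map_poly_smult hom_mult)

lemma eval_mult [simp]:
  "poly (map_poly h (p * q)) x = poly (map_poly h p) x * poly (map_poly h q) x"
  by (induction p) (simp_all add: algebra_simps)

lemma eval_power [simp]: "poly (map_poly h (p ^ n)) x = poly (map_poly h p) x ^ n"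
  by (induction n) simp_all

lemma eval_pcompose [simp]:
  "poly (map_poly h (pcompose p q)) x = poly (map_poly h p) (poly (map_poly h q) x)"
  by (induction p) (simp_all add: pcompose_pCons)

lemma eval_prod [simp]:
  "poly (map_poly h (\<Prod>i\<in>A. f i)) x = (\<Prod>i\<in>A. poly (map_poly h (f i)) x)"
  by (induction A rule: infinite_finite_induct) simp_all

end

interpretation int_eval: eval_hom "of_int :: int \<Rightarrow> 'b::comm_ring_1"
  by unfold_locales simp_all

interpretation rat_eval: eval_hom "of_rat :: rat \<Rightarrow> 'b::field_char_0"
  by unfold_locales (simp_all add: of_rat_add of_rat_mult)

abbreviation ipoly :: "int poly \<Rightarrow> 'a::comm_ring_1 \<Rightarrow> 'a"
  where "ipoly F x \<equiv> poly (map_poly of_int F) x"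

abbreviation rpoly :: "rat poly \<Rightarrow> 'a::field_char_0 \<Rightarrow> 'a"
  where "rpoly q x \<equiv> poly (map_poly of_rat q) x"

lemma rpoly_of_int_poly [simp]: "rpoly (map_poly of_int F) x = ipoly F x"
  by (simp add: map_poly_map_poly o_def)

lemma clear_denominators:
  obtains c :: int and F :: "int poly"
  where "c \<noteq> 0" and "map_poly of_int F = smult (of_int c) (q :: rat poly)"
proof (induction q arbitrary: thesis)
  case 0
  show ?case by (rule 0[of 1 0]) simp_all
next
  case (pCons a q)
  obtain c F where F: "c \<noteq> 0" "map_poly of_int F = smult (of_int c) q"
    by (rule pCons.IH)
  obtain u v where uv: "quotient_of a = (u, v)" by (cases "quotient_of a")
  have v: "v \<noteq> 0" and a: "a = of_int u / of_int v"
    using quotient_of_denom_pos[OF uv] quotient_of_div[OF uv] by simp_all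
  show ?case
  proof (rule pCons.prems)
    show "c * v \<noteq> 0" using F v by simp
    have "map_poly of_int (smult v F) = smult (of_int v) (map_poly of_int F :: rat poly)"
      by (simp add: map_poly_smult)
    then show "map_poly of_int (pCons (c * u) (smult v F)) = smult (of_int (c * v)) (pCons a q)"
      using F v by (simp add: map_poly_pCons a mult_ac)
  qed
qed

section \<open>Galois conjugacy of roots of unity\<close>

text \<open>Take an annihilator of minimal degree and make it primitive. Pseudo-division shows that it divides
  some nonzero integer multiple \<open>a F\<close> of any other annihilator \<open>F\<close>, and Gauss's lemma on contents
  removes the factor \<open>a\<close>. Dividing over \<open>\<int>\<close> rather than over \<open>\<rat>\<close> is what makes the later
  congruences modulo a prime meaningful.\<close>
lemma primitive_annihilator:
  fixes z :: "'a::{idom,ring_char_0}" and F\<^sub>0 :: "int poly"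
  assumes "F\<^sub>0 \<noteq> 0" "ipoly F\<^sub>0 z = 0"
  obtains f :: "int poly"
  where "f \<noteq> 0" "ipoly f z = 0" "\<And>F. ipoly F z = 0 \<Longrightarrow> f dvd F"
proof -
  obtain g where g: "g \<noteq> 0" "ipoly g z = 0"
    and least: "\<And>h. h \<noteq> 0 \<Longrightarrow> ipoly h z = 0 \<Longrightarrow> degree g \<le> degree h"
    using assms exists_least_iff[of "\<lambda>k. \<exists>s :: int poly. s \<noteq> 0 \<and> ipoly s z = 0 \<and> degree s = k"]
    by (metis linorder_not_less)
  define f where "f = primitive_part g"
  have gf: "g = smult (content g) f"
    by (simp add: f_def)
  have "ipoly g z = of_int (content g) * ipoly f z"
    by (subst gf) (simp only: int_eval.eval_smult)
  with g have fz: "ipoly f z = 0" by simp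
  have f0: "f \<noteq> 0" using g by (simp add: f_def)
  have cf: "content f = 1" using g by (simp add: f_def)
  have degf: "degree f = degree g" by (simp add: f_def)
  have "f dvd F" if F: "ipoly F z = 0" for F
  proof -
    obtain a q where a: "a \<noteq> 0" and aF: "smult a F = f * q + pseudo_mod F f"
      using pseudo_mod(1)[OF f0, of F] by blast
    have "ipoly (smult a F) z = ipoly (f * q + pseudo_mod F f) z"
      by (simp only: aF)
    then have "ipoly (pseudo_mod F f) z = 0" using F fz by simp
    then have "pseudo_mod F f = 0"
      using least pseudo_mod(2)[OF f0, of F] degf by (metis linorder_not_less)
    then have aF': "smult a F = f * q" using aF by simp
    \<comment> \<open>Gauss: as \<open>f\<close> is primitive, the constant \<open>a\<close> divides the cofactor \<open>q\<close>.\<close>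
    have "content (smult a F) = content f * content q"
      by (simp only: aF' content_mult)
    then have "[:a:] dvd q"
      using cf by (simp add: const_poly_dvd_iff_dvd_content) (metis abs_dvd_iff dvd_triv_left)
    then obtain q' where "q = smult a q'" by (auto elim: dvdE)
    then have "smult a F = smult a (f * q')" using aF' by simp
    then have "F = f * q'" using a by (metis smult_cancel)
    then show ?thesis by simp
  qed
  with f0 fz show thesis using that by blast
qed

lemma dvd_prime_power_add_minus:
  fixes u v :: "'a::comm_ring_1"
  assumes "prime p"
  shows "of_nat p dvd (u + v) ^ p - (u ^ p + v ^ p)"
proof -
  have p0: "p > 0" using assms prime_gt_0_nat by blast
  have "(u + v) ^ p = (\<Sum>k\<le>p. of_nat (p choose k) * u ^ k * v ^ (p - k))"
    by (rule binomial_ring)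
  also have "{..p} = insert 0 (insert p {0<..<p})" using p0 by auto
  also have "(\<Sum>k\<in>insert 0 (insert p {0<..<p}). of_nat (p choose k) * u ^ k * v ^ (p - k)) =
      v ^ p + u ^ p + (\<Sum>k\<in>{0<..<p}. of_nat (p choose k) * u ^ k * v ^ (p - k))"
    using p0 by (subst sum.insert, simp, simp)+ simp
  finally have "(u + v) ^ p - (u ^ p + v ^ p) =
      (\<Sum>k\<in>{0<..<p}. of_nat (p choose k) * u ^ k * v ^ (p - k))" by simp
  moreover have "of_nat p dvd (\<Sum>k\<in>{0<..<p}. of_nat (p choose k) * u ^ k * v ^ (p - k))"
  proof (rule dvd_sum)
    fix k assume "k \<in> {0<..<p}"
    then have "p dvd p choose k" using assms by (intro dvd_choose_prime) auto
    then obtain m where "p choose k = p * m" ..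
    then show "of_nat p dvd of_nat (p choose k) * u ^ k * v ^ (p - k)"
      by (simp add: mult.assoc)
  qed
  ultimately show ?thesis by simp
qed

lemma dvd_prime_power_minus_self:
  fixes a :: int
  assumes "prime p"
  shows "int p dvd a ^ p - a"
proof (induction a rule: int_induct[where k = 0])
  case base
  show ?case using assms prime_gt_0_nat by (simp add: zero_power)
next
  case (step1 i)
  show ?case
    using dvd_add[OF dvd_prime_power_add_minus[OF assms, of i 1] step1.IH] by (simp add: algebra_simps)
next
  case (step2 i)
  show ?case
    using dvd_diff[OF step2.IH dvd_prime_power_add_minus[OF assms, of "i - 1" 1]] by (simp add: algebra_simps)
qed

text \<open>Modulo \<open>p\<close> the map \<open>f \<mapsto> f\<^sup>p\<close> is additive and, by Fermat, fixes the integer coefficients, so it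
  only raises the variable to the \<open>p\<close>-th power.\<close>
lemma pcompose_monom_prime_cong_power:
  fixes f :: "int poly"
  assumes "prime p"
  obtains h where "pcompose f (monom 1 p) = f ^ p + smult (int p) h"
proof -
  have "of_nat p dvd f ^ p - pcompose f (monom 1 p)"
  proof (induction f)
    case 0
    have "p > 0" using assms prime_gt_0_nat by blast
    then show ?case by (simp add: zero_power)
  next
    case (pCons a f)
    have "[:int p:] dvd [:a ^ p - a:]"
      using dvd_prime_power_minus_self[OF assms, of a] by simp
    then have 1: "of_nat p dvd [:a:] ^ p - [:a:]"
      by (simp add: of_nat_poly poly_const_pow)
    have 2: "of_nat p dvd monom 1 p * (f ^ p - pcompose f (monom 1 p))"
      using pCons.IH by (rule dvd_mult)
    have 3: "of_nat p dvd ([:a:] + monom 1 1 * f) ^ p - ([:a:] ^ p + (monom 1 1 * f) ^ p)"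
      by (rule dvd_prime_power_add_minus[OF assms])
    have split: "pCons a f = [:a:] + monom 1 1 * f"
      by (simp add: monom_altdef)
    have "pcompose (pCons a f) (monom 1 p) = [:a:] + monom 1 p * pcompose f (monom 1 p)"
      by (simp add: pcompose_pCons)
    then have "pCons a f ^ p - pcompose (pCons a f) (monom 1 p) =
       (([:a:] + monom 1 1 * f) ^ p - ([:a:] ^ p + (monom 1 1 * f) ^ p))
       + ([:a:] ^ p - [:a:]) + monom 1 p * (f ^ p - pcompose f (monom 1 p))"
      by (simp only: split) (simp add: power_mult_distrib monom_power algebra_simps)
    then show ?case using 1 2 3 by (simp only: dvd_add)
  qed
  then obtain h where "f ^ p - pcompose f (monom 1 p) = of_nat p * h" ..
  then show thesis using that[of "- h"] by (simp add: of_nat_poly algebra_simps)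
qed

text \<open>Let \<open>f\<close> be the primitive annihilator of \<open>z\<close> and \<open>x\<^sup>N - 1 = f g\<close>; the task is to show \<open>f(z\<^sup>p) = 0\<close>.
  Since \<open>f(x\<^sup>p)\<close> is congruent to \<open>f(x)\<^sup>p\<close> modulo \<open>p\<close>, the number \<open>f(z\<^sup>p)\<close> is \<open>p\<close> times an element of
  \<open>\<int>[z]\<close>. If it were nonzero, \<open>z\<^sup>p\<close> would be a root of \<open>g\<close>, and differentiating \<open>x\<^sup>N - 1 = f g\<close> at
  \<open>z\<^sup>p\<close> would exhibit \<open>N z\<^bsup>p(N-1)\<^esup>\<close>, hence \<open>N\<close> itself, as \<open>p\<close> times an element of \<open>\<int>[z]\<close>. But \<open>f\<close> has leading
  coefficient \<open>1\<close> or \<open>-1\<close>, so the powers of \<open>z\<close> below the degree of \<open>f\<close> are a \<open>\<int>\<close>-basis of \<open>\<int>[z]\<close>, and comparing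
  constant coordinates gives \<open>p dvd N\<close>.\<close>
lemma annihilator_prime_power_root_of_unity:
  fixes z :: complex and F :: "int poly"
  assumes "N > 0" "z ^ N = 1" "prime p" "\<not> p dvd N" "ipoly F z = 0"
  shows "ipoly F (z ^ p) = 0"
proof -
  have z0: "z \<noteq> 0" using assms(1,2) by (metis power_0_left not_gr_zero zero_neq_one)
  define X :: "int poly" where "X = monom 1 N - 1"
  have Xz: "ipoly X w = w ^ N - 1" for w :: complex by (simp add: X_def)
  have lcX: "lead_coeff X = 1" and X0: "X \<noteq> 0"
  proof -
    have d: "degree X = N" unfolding X_def diff_conv_add_uminus using assms(1)
      by (subst degree_add_eq_left) (simp_all add: degree_monom_eq)
    then show "lead_coeff X = 1" using assms(1) by (simp add: X_def)
    then show "X \<noteq> 0" by auto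
  qed
  obtain f :: "int poly" where f0: "f \<noteq> 0" and fz: "ipoly f z = 0"
    and fdvd: "\<And>F. ipoly F z = 0 \<Longrightarrow> f dvd F"
    using primitive_annihilator[OF X0, of z] Xz[of z] assms(2) by auto
  obtain g where g: "X = f * g" using fdvd[of X] Xz[of z] assms(2) by auto
  have unit: "lead_coeff f dvd 1" using lcX unfolding g lead_coeff_mult by (metis dvd_triv_left)
  have degf: "degree f > 0"
  proof (rule ccontr)
    assume "\<not> degree f > 0"
    then obtain a where "f = [:a:]" by (metis degree_eq_zeroE not_gr_zero)
    then show False using f0 fz by simp
  qed
  obtain h where h: "pcompose f (monom 1 p) = f ^ p + smult (int p) h"
    using pcompose_monom_prime_cong_power[OF assms(3)] .
  have p0: "p > 0" using assms(3) prime_gt_0_nat by blast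
  have "ipoly (pcompose f (monom 1 p)) z = ipoly (f ^ p + smult (int p) h) z"
    by (simp only: h)
  then have fzp: "ipoly f (z ^ p) = of_nat p * ipoly h z"
    using fz p0 by (simp add: zero_power)
  have "ipoly f (z ^ p) = 0"
  proof (rule ccontr)
    assume nz: "ipoly f (z ^ p) \<noteq> 0"
    have zpN: "(z ^ p) ^ N = 1" using assms(2) by (metis mult.commute power_mult power_one)
    then have "ipoly f (z ^ p) * ipoly g (z ^ p) = 0"
      using Xz[of "z ^ p"] g by simp
    then have gzp: "ipoly g (z ^ p) = 0" using nz by simp
    have "pderiv X = f * pderiv g + g * pderiv f" by (simp add: g pderiv_mult)
    moreover have "pderiv X = monom (int N) (N - 1)"
      by (simp add: X_def pderiv_diff pderiv_monom)
    ultimately have "ipoly (monom (int N) (N - 1)) (z ^ p) = ipoly (f * pderiv g + g * pderiv f) (z ^ p)"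
      by simp
    then have deriv: "of_nat N * (z ^ p) ^ (N - 1) = of_nat p * ipoly h z * ipoly (pderiv g) (z ^ p)"
      using gzp fzp by simp
    have "of_nat N = of_nat N * ((z ^ p) ^ (N - 1) * z ^ p)"
      using zpN assms(1) by (metis Suc_diff_1 mult.commute mult.right_neutral power_Suc)
    also have "\<dots> = of_nat N * (z ^ p) ^ (N - 1) * z ^ p" by (simp only: mult.assoc)
    finally have Np: "of_nat N = of_nat p * (ipoly h z * ipoly (pderiv g) (z ^ p) * z ^ p)"
      by (simp only: deriv mult.assoc)
    define H where "H = h * pcompose (pderiv g) (monom 1 p) * monom 1 p"
    have NH: "of_nat N = of_nat p * ipoly H z"
      unfolding Np H_def by simp
    \<comment> \<open>Reduce \<open>H\<close> modulo \<open>f\<close>; the pseudo-division factor \<open>a\<close> is a unit, so nothing is lost modulo \<open>p\<close>.\<close>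
    define a where "a = lead_coeff f ^ (Suc (degree H) - degree f)"
    obtain u r where ur: "pseudo_divmod H f = (u, r)" by (cases "pseudo_divmod H f")
    have H: "smult a H = f * u + r" and r: "r = 0 \<or> degree r < degree f"
      using pseudo_divmod[OF f0 ur] by (simp_all add: a_def)
    have "ipoly (smult a H) z = ipoly (f * u + r) z" by (simp only: H)
    then have rz: "ipoly r z = of_int a * ipoly H z" using fz by simp
    define s where "s = smult (int p) r - [:a * int N:]"
    have "ipoly s z = 0" by (simp add: s_def rz NH)
    then have "f dvd s" by (rule fdvd)
    moreover have "degree s < degree f"
      unfolding s_def using r degf p0 by (intro degree_diff_less) auto
    ultimately have "s = 0" using dvd_imp_degree_le[of f s] by auto
    then have "coeff s 0 = 0" by simp
    then have "int p * coeff r 0 = a * int N" by (simp add: s_def)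
    then have "int p dvd a * int N" by (metis dvd_triv_left)
    moreover have "a dvd 1" using unit unfolding a_def by (metis dvd_power_same power_one)
    ultimately have "int p dvd int N"
      by (metis dvd_mult_unit_iff' mult.commute dvd_mult_unit_iff)
    then show False using assms(4) by simp
  qed
  moreover obtain k where "F = f * k" using fdvd[OF assms(5)] ..
  ultimately show ?thesis by simp
qed

lemma annihilator_power_root_of_unity:
  fixes z :: complex and F :: "int poly"
  assumes "N > 0" "z ^ N = 1" "coprime k N" "ipoly F z = 0"
  shows "ipoly F (z ^ k) = 0"
  using assms(3)
proof (induction k rule: prime_divisors_induct)
  case zero
  then have "N = 1" by simp
  then show ?case using assms by simp
next
  case (unit k)
  then show ?case using assms by simp
next
  case (factor p k)
  then have IH: "ipoly F (z ^ k) = 0" and "coprime p N" by (simp_all)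
  then have "\<not> p dvd N" using factor.hyps by (meson coprime_absorb_left not_prime_unit)
  moreover have "(z ^ k) ^ N = 1" using assms(2) by (metis mult.commute power_mult power_one)
  ultimately have "ipoly F ((z ^ k) ^ p) = 0"
    using annihilator_prime_power_root_of_unity assms(1) factor.hyps IH by blast
  then show ?case by (simp add: power_mult[symmetric] mult.commute)
qed

lemma ipoly_of_real: "ipoly F (complex_of_real x) = of_real (ipoly F x)"
  by (induction F) simp_all

text \<open>Conjugacy descends from \<open>z\<close> to \<open>z + 1/z\<close>: a polynomial \<open>F\<close> kills \<open>z + 1/z\<close> exactly when
  \<open>F(x + x\<^bsup>N-1\<^esup>)\<close> kills the root of unity \<open>z\<close>, and this description is the same for \<open>z\<close> and \<open>z\<^sup>k\<close>.\<close>
lemma annihilator_two_cos: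
  fixes q :: "rat poly"
  assumes "N > 0" "coprime k N" "rpoly q (2 * cos (2 * pi * real a / real N)) = 0"
  shows "rpoly q (2 * cos (2 * pi * real (a * k) / real N)) = 0"
proof -
  obtain c F where c: "c \<noteq> 0" and F: "map_poly of_int F = smult (of_int c) q"
    by (rule clear_denominators)
  have Fq: "ipoly F x = of_int c * rpoly q x" for x :: real
    by (metis F rpoly_of_int_poly rat_eval.eval_smult of_rat_of_int_eq)
  define G where "G = pcompose F (monom 1 1 + monom 1 (N - 1))"
  define z where "z = cis (2 * pi * real a / real N)"
  have two_cos: "ipoly G (cis t) = of_real (ipoly F (2 * cos t))" if "cis t ^ N = 1" for t
  proof -
    have "cis t ^ (N - 1) * cis t = 1"
      using that assms(1) by (metis Suc_diff_1 mult.commute power_Suc)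
    then have "cis t ^ (N - 1) = cis (- t)"
      by (metis cis_inverse inverse_unique mult.commute)
    then have "ipoly G (cis t) = ipoly F (cis t + cis (- t))"
      by (simp add: G_def)
    also have "cis t + cis (- t) = of_real (2 * cos t)"
      by (simp add: complex_eq_iff)
    finally show ?thesis by (simp only: ipoly_of_real)
  qed
  have zN: "z ^ N = 1"
  proof -
    have "z ^ N = cis (2 * pi * real a)" using assms(1) by (simp add: z_def Complex.DeMoivre)
    then show ?thesis by simp
  qed
  have "ipoly G z = 0"
    using two_cos zN assms(3) Fq unfolding z_def by simp
  then have "ipoly G (z ^ k) = 0"
    by (rule annihilator_power_root_of_unity[OF assms(1) zN assms(2)])
  moreover have zk: "z ^ k = cis (2 * pi * real (a * k) / real N)"
    by (simp add: z_def Complex.DeMoivre mult_ac)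
  moreover have "(z ^ k) ^ N = 1" using zN by (metis mult.commute power_mult power_one)
  ultimately show ?thesis using two_cos Fq c by simp
qed

section \<open>Minimal polynomials\<close>

lemma is_min_poly_min_poly:
  assumes "q \<noteq> 0" "rpoly q (a::real) = 0"
  shows "is_min_poly a (min_poly a)"
  unfolding min_poly_def using is_min_poly_ex1[OF assms] by (rule theI')

lemma min_poly_dvd:
  assumes "is_min_poly a p" "rpoly q a = 0"
  shows "p dvd q"
proof -
  have p0: "p \<noteq> 0" and pa: "rpoly p a = 0"
    and least: "\<And>r. r \<noteq> 0 \<Longrightarrow> rpoly r a = 0 \<Longrightarrow> degree p \<le> degree r"
    using assms(1) by (auto simp: is_min_poly_def)
  have "rpoly (p * (q div p) + q mod p) a = 0" using assms(2) by simp
  then have "rpoly (q mod p) a = 0" by (simp only: rat_eval.eval_add rat_eval.eval_mult pa)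
  then have "q mod p = 0" using least degree_mod_less'[OF p0, of q] by fastforce
  then show ?thesis by auto
qed

lemma is_min_poly_irreducible:
  assumes "is_min_poly a p"
  shows "irreducible p"
proof (rule irreducibleI)
  have least: "\<And>r. r \<noteq> 0 \<Longrightarrow> rpoly r a = 0 \<Longrightarrow> degree p \<le> degree r" and pa: "rpoly p a = 0"
    using assms by (auto simp: is_min_poly_def)
  show p0: "p \<noteq> 0" using assms by (auto simp: is_min_poly_def)
  show "\<not> p dvd 1"
  proof
    assume "p dvd 1"
    then obtain c where "p = [:c:]" using is_unit_polyE by blast
    with p0 pa show False by simp
  qed
  have unit: "s dvd 1" if "p = r * s" "rpoly r a = 0" for r s
  proof -
    have "r \<noteq> 0" "s \<noteq> 0" using that p0 by auto
    moreover have "degree p \<le> degree r" using least that(2) \<open>r \<noteq> 0\<close> by blast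
    ultimately have "degree s = 0" using that(1) by (simp add: degree_mult_eq)
    with \<open>s \<noteq> 0\<close> show ?thesis by (simp add: is_unit_iff_degree)
  qed
  fix r s assume rs: "p = r * s"
  have "rpoly r a * rpoly s a = 0" using pa unfolding rs by simp
  then show "r dvd 1 \<or> s dvd 1" using unit[of r s] unit[of s r] rs by (auto simp: mult.commute)
qed

lemma min_poly_cong:
  assumes "\<And>q. rpoly q a = 0 \<longleftrightarrow> rpoly q b = 0"
  shows "min_poly a = min_poly b"
  unfolding min_poly_def is_min_poly_def assms ..

section \<open>Trigonometric evaluation of the Chebyshev-type polynomials\<close>

text \<open>The initial values at \<open>-2\<close> and \<open>-1\<close> are chosen so that the recursion already holds from index \<open>0\<close> on.
  Hence the three derived families satisfy it from their first terms.\<close>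
lemma c_poly_rec: "n \<ge> 0 \<Longrightarrow> c_poly n = [:0, 1:] * c_poly (n - 1) - c_poly (n - 2)"
  by (cases "n = 0"; cases "n = 1") (simp_all add: c_poly.simps[of n] c_poly.simps[of "- 1"]
     c_poly.simps[of "- 2"] c_poly.simps[of 0] c_poly.simps[of 1])

lemma c_poly_minus_2: "c_poly (- 2) = - 1" and c_poly_minus_1: "c_poly (- 1) = 0"
  and c_poly_0: "c_poly 0 = 1" and c_poly_1: "c_poly 1 = [:0, 1:]"
  by (simp_all add: c_poly.simps)

lemma q_minus_0: "q_minus 0 = 2" and q_minus_1: "q_minus 1 = [:0, 1:]"
  by (simp_all add: q_minus_def c_poly_minus_2 c_poly_minus_1 c_poly_0 c_poly_1)

lemma p_minus_0: "p_minus 0 = 1" and p_minus_1: "p_minus 1 = [:- 1, 1:]"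
  by (simp_all add: p_minus_def c_poly_minus_2 c_poly_minus_1 c_poly_0 c_poly_1 one_pCons)

lemma p_plus_0: "p_plus 0 = 1" and p_plus_1: "p_plus 1 = [:1, 1:]"
  by (simp_all add: p_plus_def c_poly_minus_2 c_poly_minus_1 c_poly_0 c_poly_1 one_pCons)

lemma q_minus_rec: "q_minus (Suc (Suc k)) = [:0, 1:] * q_minus (Suc k) - q_minus k"
  using c_poly_rec[of "int k + 2"] c_poly_rec[of "int k"]
  by (simp add: q_minus_def algebra_simps del: mult_pCons_left mult_pCons_right)

lemma p_minus_rec: "p_minus (Suc (Suc k)) = [:0, 1:] * p_minus (Suc k) - p_minus k"
  using c_poly_rec[of "int k + 2"] c_poly_rec[of "int k + 1"]
  by (simp add: p_minus_def algebra_simps del: mult_pCons_left mult_pCons_right)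

lemma p_plus_rec: "p_plus (Suc (Suc k)) = [:0, 1:] * p_plus (Suc k) - p_plus k"
  using c_poly_rec[of "int k + 2"] c_poly_rec[of "int k + 1"]
  by (simp add: p_plus_def algebra_simps del: mult_pCons_left mult_pCons_right)

text \<open>The induction starts at index \<open>1\<close> because \<open>q_minus 0 = 2\<close> is not monic.\<close>
lemma rec_monic:
  fixes u :: "nat \<Rightarrow> int poly"
  assumes "\<And>k. u (Suc (Suc k)) = [:0, 1:] * u (Suc k) - u k"
    and "degree (u 0) = 0" "degree (u 1) = 1" "lead_coeff (u 1) = 1"
    and "k > 0"
  shows "degree (u k) = k \<and> coeff (u k) k = 1"
proof -
  have "degree (u (Suc k)) = Suc k \<and> lead_coeff (u (Suc k)) = 1 \<and> degree (u k) \<le> k" for k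
  proof (induction k)
    case 0
    then show ?case using assms by simp
  next
    case (Suc k)
    have eq: "u (Suc (Suc k)) = pCons 0 (u (Suc k)) + - u k" by (simp add: assms(1))
    have "u (Suc k) \<noteq> 0" using Suc by auto
    then have d: "degree (pCons 0 (u (Suc k))) = Suc (Suc k)" using Suc by simp
    then have "degree (u (Suc (Suc k))) = Suc (Suc k)"
      unfolding eq using Suc by (subst degree_add_eq_left) simp_all
    moreover have "coeff (u k) (Suc (Suc k)) = 0" using Suc by (intro coeff_eq_0) simp
    ultimately show ?case using Suc by (auto simp: eq)
  qed
  from this[of "k - 1"] show ?thesis using assms(5) by (metis Suc_diff_1)
qed

text \<open>The recursion in \<open>x = 2 cos t\<close> is the addition formula for an arithmetic progression of step \<open>t\<close>, so
  two initial values determine the closed form. The weight \<open>w\<close> accommodates closed forms with a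
  denominator, without dividing by a possibly vanishing number.\<close>
lemma rec_eval_trig:
  fixes u :: "nat \<Rightarrow> int poly" and f :: "real \<Rightarrow> real"
  assumes "\<And>k. u (Suc (Suc k)) = [:0, 1:] * u (Suc k) - u k"
    and "\<And>s. f (s + 2 * t) + f s = 2 * cos t * f (s + t)"
    and "w * ipoly (u 0) (2 * cos t) = f a" "w * ipoly (u 1) (2 * cos t) = f (a + t)"
  shows "w * ipoly (u k) (2 * cos t) = f (a + real k * t)"
proof -
  have "w * ipoly (u k) (2 * cos t) = f (a + real k * t) \<and>
    w * ipoly (u (Suc k)) (2 * cos t) = f (a + real (Suc k) * t)"
  proof (induction k)
    case 0
    then show ?case using assms by simp
  next
    case (Suc k)
    have "w * ipoly (u (Suc (Suc k))) (2 * cos t) =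
        2 * cos t * (w * ipoly (u (Suc k)) (2 * cos t)) - w * ipoly (u k) (2 * cos t)"
      by (simp add: assms(1) algebra_simps)
    also have "\<dots> = f (a + real (Suc (Suc k)) * t)"
      using Suc assms(2)[of "a + real k * t"] by (simp add: algebra_simps)
    finally show ?case using Suc by simp
  qed
  then show ?thesis ..
qed

lemma cos_step: "cos (s + 2 * t) + cos s = 2 * cos t * cos (s + t)" for s t :: real
  using cos_add[of "s + t" t] cos_diff[of "s + t" t] by (simp add: algebra_simps)

lemma sin_step: "sin (s + 2 * t) + sin s = 2 * cos t * sin (s + t)" for s t :: real
  using sin_add[of "s + t" t] sin_diff[of "s + t" t] by (simp add: algebra_simps)

lemma ipoly_2 [simp]: "ipoly 2 (x :: 'a::comm_ring_1) = 2"
  by (simp add: numeral_poly)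

lemma q_minus_two_cos: "ipoly (q_minus k) (2 * cos t) = 2 * cos (real k * t)" for t :: real
  using rec_eval_trig[of q_minus cos t "1/2" 0 k] 
  by (simp add: q_minus_rec cos_step q_minus_0 q_minus_1[unfolded One_nat_def])

lemma p_minus_two_cos: "cos (t / 2) * ipoly (p_minus k) (2 * cos t) = cos ((2 * real k + 1) * t / 2)" for t :: real
proof -
  have "cos (t / 2) * (2 * cos t - 1) = cos (t / 2 + t)"
    using cos_step[of "- t / 2" t] by (simp add: algebra_simps)
  then show ?thesis
    using rec_eval_trig[of p_minus cos t "cos (t / 2)" "t / 2" k, OF p_minus_rec cos_step]
    by (simp add: p_minus_0 p_minus_1[unfolded One_nat_def] field_simps)
qed

lemma p_plus_two_cos: "sin (t / 2) * ipoly (p_plus k) (2 * cos t) = sin ((2 * real k + 1) * t / 2)" for t :: real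
proof -
  have "sin (t / 2) * (2 * cos t + 1) = sin (t / 2 + t)"
    using sin_step[of "- t / 2" t] by (simp add: algebra_simps)
  then show ?thesis
    using rec_eval_trig[of p_plus sin t "sin (t / 2)" "t / 2" k, OF p_plus_rec sin_step]
    by (simp add: p_plus_0 p_plus_1[unfolded One_nat_def] field_simps)
qed

lemma degree_q_minus: "k > 0 \<Longrightarrow> degree (q_minus k) = k"
  and coeff_q_minus_self: "k > 0 \<Longrightarrow> coeff (q_minus k) k = 1"
  using rec_monic[of q_minus k, OF q_minus_rec] by (auto simp: q_minus_0 q_minus_1[unfolded One_nat_def])

lemma degree_p_minus: "degree (p_minus k) = k"
  and coeff_p_minus_self: "coeff (p_minus k) k = 1"
  using rec_monic[of p_minus k, OF p_minus_rec]
  by (cases "k = 0"; auto simp: p_minus_0 p_minus_1[unfolded One_nat_def])+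

lemma degree_p_plus: "degree (p_plus k) = k"
  and coeff_p_plus_self: "coeff (p_plus k) k = 1"
  using rec_monic[of p_plus k, OF p_plus_rec]
  by (cases "k = 0"; auto simp: p_plus_0 p_plus_1[unfolded One_nat_def])+

section \<open>Factorization into minimal polynomials\<close>

text \<open>The witness is \<open>q_minus N - 2\<close>. Besides algebraicity this polynomial records the order: \<open>2 cos (2\<pi>/M)\<close>
  is a root of it only if \<open>M dvd N\<close>.\<close>
lemma two_cos_algebraic:
  assumes "N > 0"
  obtains q where "q \<noteq> 0" "\<And>t :: real. rpoly q (2 * cos t) = 2 * cos (real N * t) - 2"
proof
  let ?q = "map_poly rat_of_int (q_minus N - 2)"
  have "degree (q_minus N) > 0" using degree_q_minus assms by simp
  then have "q_minus N \<noteq> 2" by (metis degree_numeral less_irrefl)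
  then show "?q \<noteq> 0" by (simp add: map_poly_eq_0_iff)
  show "rpoly ?q (2 * cos t) = 2 * cos (real N * t) - 2" for t :: real
    by (simp add: q_minus_two_cos)
qed

lemma is_min_poly_psi:
  assumes "N > 0"
  shows "is_min_poly (2 * cos (2 * pi / real N)) (psi N)"
proof -
  obtain q where q: "q \<noteq> 0" "\<And>t :: real. rpoly q (2 * cos t) = 2 * cos (real N * t) - 2"
    using two_cos_algebraic[OF assms] by blast
  have "rpoly q (2 * cos (2 * pi / real N)) = 0" using q(2) assms by simp
  with q(1) show ?thesis unfolding psi_def by (rule is_min_poly_min_poly)
qed

text \<open>Conjugacy is symmetric because \<open>k\<close> is invertible modulo \<open>N\<close>.\<close>
lemma annihilator_two_cos_iff:
  fixes q :: "rat poly"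
  assumes "N > 0" "coprime k N"
  shows "rpoly q (2 * cos (2 * pi * real k / real N)) = 0 \<longleftrightarrow> rpoly q (2 * cos (2 * pi / real N)) = 0"
proof
  assume "rpoly q (2 * cos (2 * pi / real N)) = 0"
  then show "rpoly q (2 * cos (2 * pi * real k / real N)) = 0"
    using annihilator_two_cos[OF assms, of q 1] by simp
next
  assume *: "rpoly q (2 * cos (2 * pi * real k / real N)) = 0"
  obtain l where l: "[k * l = 1] (mod N)" using cong_solve_coprime_nat[OF assms(2)] by auto
  then have "coprime l N" by (metis assms(2) cong_imp_coprime cong_sym coprime_1_left coprime_mult_left_iff)
  from annihilator_two_cos[OF assms(1) this *]
  have "rpoly q (2 * cos (2 * pi * real (k * l) / real N)) = 0" .
  moreover have "cos (2 * pi * real (k * l) / real N) = cos (2 * pi / real N)"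
  proof -
    obtain j :: int where "int (k * l) = 1 + int N * j"
      using l by (metis cong_int_iff cong_iff_lin cong_sym of_nat_1)
    then have "real (k * l) = 1 + real N * of_int j"
      by (metis of_int_1 of_int_add of_int_mult of_int_of_nat_eq)
    then have "2 * pi * real (k * l) / real N = 2 * pi / real N + 2 * pi * of_int j"
      using assms(1) by (simp add: field_simps)
    then show ?thesis by (simp add: cos_add)
  qed
  ultimately show "rpoly q (2 * cos (2 * pi / real N)) = 0" by simp
qed

lemma min_poly_two_cos:
  assumes "N > 0" "coprime k N"
  shows "min_poly (2 * cos (2 * pi * real k / real N)) = psi N"
  unfolding psi_def by (rule min_poly_cong) (rule annihilator_two_cos_iff[OF assms])

text \<open>If \<open>psi M\<close> divides \<open>psi N\<close>, then \<open>2 cos (2\<pi>/M)\<close> is a root of every rational polynomial that kills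
  \<open>2 cos (2\<pi>/N)\<close>, which forces \<open>M dvd N\<close>. Divisibility between irreducible polynomials is symmetric, so distinct indices
  give coprime polynomials.\<close>
lemma coprime_psi:
  assumes "M > 0" "N > 0" "M \<noteq> N"
  shows "coprime (psi M) (psi N)"
proof -
  have dvd: "M dvd N" if M: "M > 0" and N: "N > 0" and MN: "psi M dvd psi N" for M N
  proof -
    obtain r where r: "psi N = psi M * r" using MN ..
    obtain q where q: "q \<noteq> 0" "\<And>t :: real. rpoly q (2 * cos t) = 2 * cos (real N * t) - 2"
      using two_cos_algebraic[OF N] by blast
    have "psi N dvd q" using q(2) N by (intro min_poly_dvd[OF is_min_poly_psi[OF N]]) simp
    then obtain s where s: "q = psi N * s" ..
    have "rpoly q (2 * cos (2 * pi / real M)) = 0"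
      using is_min_poly_psi[OF M] unfolding s r is_min_poly_def by simp
    then have "cos (real N * (2 * pi / real M)) = 1" by (simp add: q(2))
    then obtain j :: int where "real N * (2 * pi / real M) = j * 2 * pi" by (auto simp: cos_one_2pi_int)
    then have "real N = of_int j * real M" using M by (simp add: field_simps)
    then have "int N = j * int M" by (metis of_int_eq_iff of_int_mult of_int_of_nat_eq)
    then show "M dvd N" by (metis dvd_triv_right int_dvd_int_iff)
  qed
  have "\<not> psi M dvd psi N"
  proof
    assume *: "psi M dvd psi N"
    then obtain r where r: "psi N = psi M * r" ..
    have "irreducible (psi N)" "\<not> psi M dvd 1"
      using is_min_poly_irreducible[OF is_min_poly_psi] assms irreducible_not_unit by blast+
    then have "r dvd 1" using irreducibleD[OF _ r] by blast
    then have "psi N dvd psi M" unfolding r by (simp add: mult_unit_dvd_iff)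
    with * show False using dvd assms by (metis dvd_antisym)
  qed
  then show ?thesis
    using is_min_poly_irreducible[OF is_min_poly_psi[OF assms(1)]]
    by (metis irreducible_imp_prime_elem prime_elem_imp_coprime)
qed

lemma monic_psi: "N > 0 \<Longrightarrow> lead_coeff (psi N) = 1"
  using is_min_poly_psi by (simp add: is_min_poly_def)

text \<open>The polynomial \<open>q\<close> has the distinct roots \<open>2 cos (2\<pi>a/L)\<close> for \<open>a \<in> A\<close>. A numerator \<open>a\<close> with \<open>gcd a L = d\<close>
  gives a conjugate of \<open>2 cos (2\<pi>d/L) = 2 cos (2\<pi>/(L/d))\<close>, so the classes of conjugate roots are
  indexed by the divisors of \<open>L\<close> in \<open>A\<close>. The product of the corresponding \<open>psi\<close> divides \<open>q\<close>, because its factors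
  are pairwise coprime divisors of \<open>q\<close>; on the other hand it has all roots of \<open>q\<close>, so its degree is at
  least that of \<open>q\<close>.\<close>
lemma prod_psi_eqI:
  fixes q :: "rat poly" and A :: "nat set"
  assumes L: "L > 0" and fin: "finite A" and A: "\<And>a. a \<in> A \<Longrightarrow> 2 * a \<le> L"
    and gcd: "\<And>a. a \<in> A \<Longrightarrow> gcd a L \<in> A"
    and q: "lead_coeff q = 1" "degree q = card A"
    and roots: "\<And>a. a \<in> A \<Longrightarrow> rpoly q (2 * cos (2 * pi * real a / real L)) = 0"
  shows "q = (\<Prod>d | d \<in> A \<and> d dvd L. psi (L div d))"
proof -
  let ?D = "{d. d \<in> A \<and> d dvd L}" and ?x = "\<lambda>a. 2 * cos (2 * pi * real a / real L)"
  define P where "P = (\<Prod>d\<in>?D. psi (L div d))"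
  have finD: "finite ?D" using fin by simp
  have pos: "L div d > 0" "d > 0" if "d dvd L" for d
    using that L by (auto simp: div_greater_zero_iff dvd_imp_le dvd_pos_nat)
  have reduce: "?x (d * b) = 2 * cos (2 * pi * real b / real (L div d))" if "d dvd L" for b d
  proof -
    have "real L = real d * real (L div d)" using that by (metis dvd_mult_div_cancel of_nat_mult)
    then show ?thesis using pos(2)[OF that] by (simp add: mult_ac del: of_nat_div)
  qed
  have dvd: "psi (L div d) dvd q" if "d \<in> ?D" for d
    using roots[of d] reduce[of d 1] that pos
    by (intro min_poly_dvd[OF is_min_poly_psi]) auto
  have "(\<Prod>d\<in>E. psi (L div d)) dvd q" if "E \<subseteq> ?D" for E
    using finite_subset[OF that finD] that
  proof (induction E rule: finite_induct)
    case (insert d E)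
    have "coprime (psi (L div d)) (psi (L div e))" if "e \<in> E" for e
    proof (rule coprime_psi)
      have "d \<noteq> e" "d dvd L" "e dvd L" using insert that by auto
      then show "L div d \<noteq> L div e" "L div d > 0" "L div e > 0"
        using pos by (auto, metis dvd_div_mult_self mult_left_cancel neq0_conv)
    qed
    then have "coprime (psi (L div d)) (\<Prod>e\<in>E. psi (L div e))"
      by (rule prod_coprime_right)
    moreover have "psi (L div d) dvd q" using insert.prems dvd by auto
    ultimately show ?case using insert by (simp add: divides_mult)
  qed simp
  then have "P dvd q" by (simp add: P_def)
  then obtain r where r: "q = P * r" ..
  have "lead_coeff P = 1"
    unfolding P_def using pos by (subst lead_coeff_prod) (auto intro!: prod.neutral simp: monic_psi)
  then have P0: "P \<noteq> 0" by auto
  have q0: "q \<noteq> 0" using q by auto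
  have "rpoly P (?x a) = 0" if "a \<in> A" for a
  proof -
    define d where "d = gcd a L"
    have d: "d \<in> ?D" using gcd[OF that] by (simp add: d_def)
    have "coprime (a div d) (L div d)"
      unfolding d_def using L by (intro div_gcd_coprime) auto
    then have "rpoly (psi (L div d)) (2 * cos (2 * pi * real (a div d) / real (L div d))) = 0"
      using is_min_poly_psi[of "L div d"] pos d by (subst annihilator_two_cos_iff) (auto simp: is_min_poly_def)
    then have "rpoly (psi (L div d)) (?x a) = 0"
      using reduce[of d "a div d"] d by (simp add: d_def)
    then show ?thesis
      unfolding P_def rat_eval.eval_prod using finD d by (auto simp: prod_zero_iff)
  qed
  then have sub: "?x ` A \<subseteq> {x. rpoly P x = 0}" by auto
  \<comment> \<open>The bound \<open>2 a \<le> L\<close> keeps all angles in \<open>[0, \<pi>]\<close>, where the cosine is injective.\<close>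
  have "inj_on ?x A"
  proof (rule inj_onI)
    fix a b assume ab: "a \<in> A" "b \<in> A" "?x a = ?x b"
    have range: "0 \<le> 2 * pi * real c / real L" "2 * pi * real c / real L \<le> pi" if "c \<in> A" for c
    proof -
      have "2 * real c \<le> real L" using A[OF that] by (metis of_nat_le_iff of_nat_mult of_nat_numeral)
      then show "2 * pi * real c / real L \<le> pi" using L by (simp add: field_simps)
    qed simp
    have "cos (2 * pi * real a / real L) = cos (2 * pi * real b / real L)" using ab(3) by simp
    then have "2 * pi * real a / real L = 2 * pi * real b / real L"
      by (rule cos_inj_pi[OF range[OF ab(1)] range[OF ab(2)]])
    then show "a = b" using L by simp
  qed
  then have "degree q = card (?x ` A)" using q by (simp add: card_image)
  also have "\<dots> \<le> card {x :: real. rpoly P x = 0}"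
    using P0 by (intro card_mono sub poly_roots_finite) (simp add: map_poly_eq_0_iff)
  also have "\<dots> \<le> degree P"
    using P0 card_poly_roots_bound[of "map_poly of_rat P :: real poly"]
    by (simp add: map_poly_eq_0_iff degree_map_poly)
  finally have "degree r = 0"
    using q0 r by (auto simp: degree_mult_eq)
  moreover have "lead_coeff r = 1"
    using q(1) \<open>lead_coeff P = 1\<close> unfolding r lead_coeff_mult by simp
  ultimately have "r = 1" by (metis degree_eq_zeroE lead_coeff_pCons(2) coeff_pCons_0 one_pCons)
  then show ?thesis using r by (simp add: P_def)
qed

lemma to_fract_prod: "to_fract (\<Prod>i\<in>A. f i) = (\<Prod>i\<in>A. to_fract (f i))"
  by (induction A rule: infinite_finite_induct) simp_all

lemma int_to_ratfun_prod_psi: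
  fixes F :: "int poly" and A :: "nat set"
  assumes "L > 0" "finite A" "\<And>a. a \<in> A \<Longrightarrow> 2 * a \<le> L" "\<And>a. a \<in> A \<Longrightarrow> gcd a L \<in> A"
    and "lead_coeff F = 1" "degree F = card A"
    and "\<And>a. a \<in> A \<Longrightarrow> ipoly F (2 * cos (2 * pi * real a / real L)) = 0"
  shows "int_to_ratfun F = (\<Prod>d | d \<in> A \<and> d dvd L. to_fract (psi (L div d)))"
  unfolding int_to_ratfun_def to_fract_prod[symmetric] to_fract_eq_iff
  using assms by (intro prod_psi_eqI) (simp_all add: degree_map_poly coeff_map_poly)

lemma card_odd_less: "card {a. odd a \<and> a < n} = n div 2"
proof -
  have "{a. odd a \<and> a < n} = (\<lambda>i. 2 * i + 1) ` {..<n div 2}"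
    by (auto elim!: oddE simp: image_iff)
  also have "card \<dots> = n div 2" by (subst card_image) (auto simp: inj_on_def)
  finally show ?thesis .
qed

lemma cos_odd_mult_pi_half: "odd a \<Longrightarrow> cos (real a * pi / 2) = 0"
proof -
  assume "odd a"
  then obtain k where "a = 2 * k + 1" by (rule oddE)
  then have "real a * pi / 2 = real k * pi + pi / 2" by (simp add: field_simps)
  then show ?thesis by (simp only: cos_add cos_pi_half sin_npi mult_zero_left mult_zero_right diff_self)
qed

text \<open>In the first two cases the roots are \<open>2 cos (a\<pi>/n)\<close> with \<open>a\<close> odd, written over the denominator
  \<open>L = 2 n\<close>; in the last one they are \<open>2 cos (2\<pi>a/n)\<close>. All three are indexed by the odd proper
  divisors of \<open>n\<close>, so that one inversion argument serves them all.\<close>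
lemma p_minus_eq_prod_psi:
  assumes "odd n"
  shows "int_to_ratfun (p_minus (n div 2)) =
    (\<Prod>d | d dvd n \<and> odd d \<and> d < n. to_fract (psi (2 * (n div d))))"
proof -
  let ?A = "{a. odd a \<and> a < n}"
  have n: "n > 0" using assms odd_pos by blast
  have "int_to_ratfun (p_minus (n div 2)) = (\<Prod>d | d \<in> ?A \<and> d dvd 2 * n. to_fract (psi (2 * n div d)))"
  proof (rule int_to_ratfun_prod_psi)
    fix a assume a: "a \<in> ?A"
    show "gcd a (2 * n) \<in> ?A"
      using a le_less_trans[OF gcd_le1_nat[of a "2 * n"], of n] by (cases "a = 0") (auto elim: dvd_trans)
    define t where "t = 2 * pi * real a / real (2 * n)"
    have "cos (t / 2) * ipoly (p_minus (n div 2)) (2 * cos t) = cos ((2 * real (n div 2) + 1) * t / 2)"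
      by (rule p_minus_two_cos)
    also have "2 * real (n div 2) + 1 = real n"
      using assms by (metis of_nat_1 of_nat_add of_nat_mult of_nat_numeral odd_two_times_div_two_succ)
    also have "real n * t / 2 = real a * pi / 2" using n by (simp add: t_def)
    also have "cos (real a * pi / 2) = 0" using a by (simp add: cos_odd_mult_pi_half)
    finally have "cos (t / 2) * ipoly (p_minus (n div 2)) (2 * cos t) = 0" .
    moreover have "cos (t / 2) > 0"
    proof (rule cos_gt_zero_pi)
      have "0 \<le> t" by (simp add: t_def)
      then show "- (pi / 2) < t / 2" using pi_gt_zero by linarith
      show "t / 2 < pi / 2" using a n by (simp add: t_def field_simps)
    qed
    ultimately show "ipoly (p_minus (n div 2)) (2 * cos t) = 0" by simp
  qed (use n in \<open>auto simp: card_odd_less degree_p_minus coeff_p_minus_self\<close>)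
  also have "{d. d \<in> ?A \<and> d dvd 2 * n} = {d. d dvd n \<and> odd d \<and> d < n}"
    by (auto simp: coprime_dvd_mult_right_iff)
  also have "(\<Prod>d\<in>\<dots>. to_fract (psi (2 * n div d))) = (\<Prod>d\<in>\<dots>. to_fract (psi (2 * (n div d))))"
    by (intro prod.cong) (auto simp: div_mult_swap)
  finally show ?thesis .
qed

lemma q_minus_eq_prod_psi:
  assumes "even n" "n > 0"
  shows "int_to_ratfun (q_minus (n div 2)) =
    (\<Prod>d | d dvd n \<and> odd d \<and> d < n. to_fract (psi (2 * (n div d))))"
proof -
  let ?A = "{a. odd a \<and> a < n}"
  have "int_to_ratfun (q_minus (n div 2)) = (\<Prod>d | d \<in> ?A \<and> d dvd 2 * n. to_fract (psi (2 * n div d)))"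
  proof (rule int_to_ratfun_prod_psi)
    fix a assume a: "a \<in> ?A"
    show "gcd a (2 * n) \<in> ?A"
      using a le_less_trans[OF gcd_le1_nat[of a "2 * n"], of n] by (cases "a = 0") (auto elim: dvd_trans)
    have "real (n div 2) * (2 * pi * real a / real (2 * n)) = real a * pi / 2"
      using assms by (auto elim!: evenE)
    moreover have "cos (real a * pi / 2) = 0" using a by (simp add: cos_odd_mult_pi_half)
    ultimately show "ipoly (q_minus (n div 2)) (2 * cos (2 * pi * real a / real (2 * n))) = 0"
      by (simp only: q_minus_two_cos)
  qed (use assms in \<open>auto simp: card_odd_less degree_q_minus coeff_q_minus_self dvd_imp_le div_greater_zero_iff\<close>)
  also have "{d. d \<in> ?A \<and> d dvd 2 * n} = {d. d dvd n \<and> odd d \<and> d < n}"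
    by (auto simp: coprime_dvd_mult_right_iff)
  also have "(\<Prod>d\<in>\<dots>. to_fract (psi (2 * n div d))) = (\<Prod>d\<in>\<dots>. to_fract (psi (2 * (n div d))))"
    by (intro prod.cong) (auto simp: div_mult_swap)
  finally show ?thesis .
qed

lemma p_plus_eq_prod_psi:
  assumes "odd n"
  shows "int_to_ratfun (p_plus (n div 2)) =
    (\<Prod>d | d dvd n \<and> odd d \<and> d < n. to_fract (psi (n div d)))"
proof -
  let ?A = "{1..n div 2}"
  have n: "n > 0" using assms odd_pos by blast
  have "int_to_ratfun (p_plus (n div 2)) = (\<Prod>d | d \<in> ?A \<and> d dvd n. to_fract (psi (n div d)))"
  proof (rule int_to_ratfun_prod_psi)
    fix a assume a: "a \<in> ?A"
    show "gcd a n \<in> ?A"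
      using a n le_trans[OF gcd_le1_nat[of a n], of "n div 2"] by (auto simp: Suc_le_eq)
    define t where "t = 2 * pi * real a / real n"
    have "sin (t / 2) * ipoly (p_plus (n div 2)) (2 * cos t) = sin ((2 * real (n div 2) + 1) * t / 2)"
      by (rule p_plus_two_cos)
    also have "2 * real (n div 2) + 1 = real n"
      using assms by (metis of_nat_1 of_nat_add of_nat_mult of_nat_numeral odd_two_times_div_two_succ)
    also have "real n * t / 2 = real a * pi" using n by (simp add: t_def)
    finally have "sin (t / 2) * ipoly (p_plus (n div 2)) (2 * cos t) = 0" by simp
    moreover have "sin (t / 2) > 0"
      using a n by (intro sin_gt_zero) (auto simp: t_def field_simps)
    ultimately show "ipoly (p_plus (n div 2)) (2 * cos t) = 0" by simp
  qed (use n in \<open>auto simp: degree_p_plus coeff_p_plus_self\<close>)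
  also have "{d. d \<in> ?A \<and> d dvd n} = {d. d dvd n \<and> odd d \<and> d < n}"
  proof -
    have "d \<le> n div 2" if d: "d dvd n" "d < n" for d
    proof -
      obtain k where k: "n = d * k" using d(1) ..
      then have "k \<noteq> 0" "k \<noteq> 1" using n d(2) by auto
      then have "d * 2 \<le> n" unfolding k by (intro mult_le_mono2) simp
      then show ?thesis by simp
    qed
    moreover have "odd d" "1 \<le> d" if "d dvd n" for d
      using that assms n by (auto simp: Suc_le_eq dvd_pos_nat)
    moreover have "d < n" if "d \<le> n div 2" for d using that n by auto
    ultimately show ?thesis by auto
  qed
  finally show ?thesis .
qed

section \<open>Inversion over the odd divisors\<close>

text \<open>Induction on the set \<open>I\<close> of properties: the subsets that contain the new property \<open>p\<close> contribute the
  inverse of the same product taken over the \<open>d\<close> that have property \<open>p\<close>, and this cancels exactly those \<open>d\<close>.\<close>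
lemma prod_inclusion_exclusion:
  fixes g :: "'b \<Rightarrow> 'a::field" and Q :: "'p \<Rightarrow> 'b \<Rightarrow> bool"
  assumes "finite I" "finite D" "\<And>d. d \<in> D \<Longrightarrow> g d \<noteq> 0"
  shows "(\<Prod>S\<in>Pow I. (\<Prod>d | d \<in> D \<and> (\<forall>p\<in>S. Q p d). g d) powi ((- 1) ^ card S)) =
    (\<Prod>d | d \<in> D \<and> (\<forall>p\<in>I. \<not> Q p d). g d)"
  using assms
proof (induction I arbitrary: D rule: finite_induct)
  case empty
  then show ?case by simp
next
  case (insert p I)
  let ?G = "\<lambda>D S. \<Prod>d | d \<in> D \<and> (\<forall>p\<in>S. Q p d). g d"
  let ?E = "{d \<in> D. Q p d}"
  let ?X = "\<Prod>d | d \<in> D \<and> (\<forall>p\<in>I. \<not> Q p d). g d" and ?Y = "\<Prod>d | d \<in> ?E \<and> (\<forall>p\<in>I. \<not> Q p d). g d"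
    and ?Z = "\<Prod>d | d \<in> D \<and> (\<forall>p\<in>insert p I. \<not> Q p d). g d"
  have fin: "finite S" if "S \<in> Pow I" for S using that insert.hyps finite_subset by auto
  have inj: "inj_on (insert p) (Pow I)" using insert.hyps by (auto simp: inj_on_def)
  have "(\<Prod>S\<in>Pow (insert p I). ?G D S powi ((- 1) ^ card S)) =
      (\<Prod>S\<in>Pow I. ?G D S powi ((- 1) ^ card S)) * (\<Prod>S\<in>insert p ` Pow I. ?G D S powi ((- 1) ^ card S))"
    unfolding Pow_insert using insert.hyps by (intro prod.union_disjoint) auto
  also have "(\<Prod>S\<in>insert p ` Pow I. ?G D S powi ((- 1) ^ card S)) =
      (\<Prod>S\<in>Pow I. ?G D (insert p S) powi ((- 1) ^ card (insert p S)))"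
    using inj by (simp add: prod.reindex)
  also have "\<dots> = (\<Prod>S\<in>Pow I. inverse (?G ?E S powi ((- 1) ^ card S)))"
  proof (rule prod.cong[OF refl])
    fix S assume S: "S \<in> Pow I"
    then have "card (insert p S) = Suc (card S)" using fin insert.hyps by (intro card_insert_disjoint) auto
    moreover have "?G D (insert p S) = ?G ?E S" by (intro prod.cong) auto
    ultimately show "?G D (insert p S) powi ((- 1) ^ card (insert p S)) = inverse (?G ?E S powi ((- 1) ^ card S))"
      by (simp add: power_int_minus)
  qed
  also have "\<dots> = inverse (\<Prod>S\<in>Pow I. ?G ?E S powi ((- 1) ^ card S))"
    by (simp only: prod_inversef[symmetric] o_def)
  also have "(\<Prod>S\<in>Pow I. ?G D S powi ((- 1) ^ card S)) = ?X" using insert by blast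
  also have "(\<Prod>S\<in>Pow I. ?G ?E S powi ((- 1) ^ card S)) = ?Y" using insert.prems by (intro insert.IH) auto
  also have "?X = ?Y * ?Z"
  proof -
    have "{d. d \<in> D \<and> (\<forall>p\<in>I. \<not> Q p d)} = {d. d \<in> ?E \<and> (\<forall>p\<in>I. \<not> Q p d)} \<union> {d. d \<in> D \<and> (\<forall>p\<in>insert p I. \<not> Q p d)}"
      by auto
    then show ?thesis
      using insert.prems(1) by (simp only:) (rule prod.union_disjoint, auto)
  qed
  also have "?Y * ?Z * inverse ?Y = ?Z"
  proof -
    have "?Y \<noteq> 0" using insert.prems by (auto simp: prod_zero_iff)
    then show ?thesis by simp
  qed
  finally show ?case .
qed

definition odd_primes :: "nat \<Rightarrow> nat set" where
  "odd_primes n = {p. prime p \<and> odd p \<and> p dvd n}"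

lemma finite_odd_primes: "n > 0 \<Longrightarrow> finite (odd_primes n)"
  by (rule finite_subset[of _ "{..n}"]) (auto simp: odd_primes_def dvd_imp_le)

lemma dvd_prod_primes_iff:
  fixes S :: "nat set"
  assumes "finite S" "\<And>p. p \<in> S \<Longrightarrow> prime p"
  shows "\<Prod>S dvd d \<longleftrightarrow> (\<forall>p\<in>S. p dvd d)"
  using assms
proof (induction S rule: finite_induct)
  case (insert p S)
  have "coprime p (\<Prod>S)"
    using insert by (intro prod_coprime_right) (metis insertCI primes_coprime)
  then have "p * \<Prod>S dvd d \<longleftrightarrow> p dvd d \<and> \<Prod>S dvd d"
    by (auto intro: divides_mult dvd_mult_left dvd_mult_right)
  then show ?case using insert by simp
qed simp

lemma inj_on_prod_primes:
  assumes "\<And>S. S \<in> X \<Longrightarrow> finite S \<and> (\<forall>p\<in>S. prime (p::nat))"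
  shows "inj_on (\<lambda>S. \<Prod>S) X"
proof (rule inj_onI)
  have *: "S \<subseteq> T" if ST: "S \<in> X" "T \<in> X" "\<Prod>S = \<Prod>T" for S T
  proof
    fix p assume p: "p \<in> S"
    then have "p dvd \<Prod>T" using assms[OF ST(1)] ST(3) by (metis dvd_prodI id_apply)
    then obtain r where "r \<in> T" "p dvd r"
      using assms ST(1,2) p by (auto simp: prime_dvd_prod_iff)
    then show "p \<in> T" using assms ST(1,2) p by (metis primes_dvd_imp_eq)
  qed
  fix S T assume "S \<in> X" "T \<in> X" "\<Prod>S = \<Prod>T"
  then show "S = T" using *[of S T] *[of T S] by auto
qed

lemma Pi_set_eq: "Pi_set i n = (\<lambda>S. \<Prod>S) ` {S. S \<subseteq> odd_primes n \<and> card S = i \<and> \<Prod>S < n}"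
  by (auto simp: Pi_set_def odd_primes_def)

lemma power_int_prod: "(\<Prod>i\<in>A. f i) powi k = (\<Prod>i\<in>A. f i powi k)" for f :: "_ \<Rightarrow> 'a::field"
  by (induction A rule: infinite_finite_induct) (simp_all add: power_int_mult_distrib)

text \<open>Sorting the sets \<open>S\<close> of odd primes by cardinality turns the left-hand side into the iterated product over
  \<open>Pi_set i n\<close>. Sets whose product is all of \<open>n\<close> do not occur in \<open>Pi_set\<close>; they exist only for odd \<open>n\<close> and
  contribute the factor \<open>H n = 1\<close>. The bound \<open>card (Pi_set 1 n)\<close> is the number of odd primes dividing \<open>n\<close>,
  except when \<open>n\<close> is an odd prime: then it is \<open>0\<close>, and only the empty set has product below \<open>n\<close>.\<close>
lemma prod_Pow_odd_primes:
  fixes H :: "nat \<Rightarrow> 'a::field"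
  assumes n: "n > 1" and Hn: "odd n \<Longrightarrow> H n = 1"
  shows "(\<Prod>S\<in>Pow (odd_primes n). H (\<Prod>S) powi ((- 1) ^ card S)) =
    H 1 * (\<Prod>i = 1..card (Pi_set 1 n). (\<Prod>d\<in>Pi_set i n. H d) powi ((- 1) ^ i))"
proof -
  let ?P = "odd_primes n"
  let ?W = "{S. S \<subseteq> ?P \<and> \<Prod>S < n}"
  have finP: "finite ?P" using n by (intro finite_odd_primes) simp
  have fin: "finite S \<and> (\<forall>p\<in>S. prime p)" if "S \<subseteq> ?P" for S
    using that finP finite_subset by (auto simp: odd_primes_def)
  have inj: "inj_on (\<lambda>S. \<Prod>S) X" if "X \<subseteq> Pow ?P" for X
    using that fin by (intro inj_on_prod_primes) auto
  have le: "\<Prod>S \<le> n" if "S \<subseteq> ?P" for S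
    using that fin[OF that] n by (intro dvd_imp_le) (auto simp: dvd_prod_primes_iff odd_primes_def)
  have finW: "finite ?W" using finP by (rule finite_subset[rotated, OF iffD2[OF finite_Pow_iff]]) auto
  have card_le: "card S \<le> card (Pi_set 1 n)" if S: "S \<in> ?W" for S
  proof -
    have "p < n" if p: "p \<in> S" for p
    proof -
      have "p dvd \<Prod>S" using fin S p by (metis (no_types, lifting) dvd_prodI id_apply mem_Collect_eq)
      moreover have "\<Prod>S > 0" using fin S by (auto intro!: prod_pos prime_gt_0_nat)
      ultimately have "p \<le> \<Prod>S" by (rule dvd_imp_le)
      then show ?thesis using S by simp
    qed
    then have "S \<subseteq> Pi_set 1 n"
      using S by (force simp: Pi_set_eq image_iff intro!: exI[of _ "{_}"])
    moreover have "finite (Pi_set 1 n)" unfolding Pi_set_eq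
      by (intro finite_imageI finite_subset[OF _ finW]) auto
    ultimately show ?thesis by (simp add: card_mono)
  qed
  have "(\<Prod>S\<in>Pow ?P. H (\<Prod>S) powi ((- 1) ^ card S)) = (\<Prod>S\<in>?W. H (\<Prod>S) powi ((- 1) ^ card S))"
  proof (rule prod.mono_neutral_right)
    show "\<forall>S\<in>Pow ?P - ?W. H (\<Prod>S) powi ((- 1) ^ card S) = 1"
    proof
      fix S assume S: "S \<in> Pow ?P - ?W"
      then have "\<Prod>S = n" using le[of S] by auto
      moreover have "odd (\<Prod>S)" using S fin[of S] by (auto simp: even_prod_iff odd_primes_def)
      ultimately show "H (\<Prod>S) powi ((- 1) ^ card S) = 1" using Hn by simp
    qed
  qed (use finP in auto)
  also have "\<dots> = (\<Prod>i\<in>{0..card (Pi_set 1 n)}. \<Prod>S | S \<in> ?W \<and> card S = i. H (\<Prod>S) powi ((- 1) ^ card S))"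
    using card_le by (intro prod.group[symmetric, where g = card] finW) auto
  also have "\<dots> = (\<Prod>i\<in>{0..card (Pi_set 1 n)}. (\<Prod>d\<in>Pi_set i n. H d) powi ((- 1) ^ i))"
  proof (rule prod.cong[OF refl])
    fix i
    have "(\<Prod>d\<in>Pi_set i n. H d) = (\<Prod>S | S \<in> ?W \<and> card S = i. H (\<Prod>S))"
      unfolding Pi_set_eq by (subst prod.reindex[OF inj]) (auto intro!: prod.cong)
    then show "(\<Prod>S | S \<in> ?W \<and> card S = i. H (\<Prod>S) powi ((- 1) ^ card S)) = (\<Prod>d\<in>Pi_set i n. H d) powi ((- 1) ^ i)"
      by (simp add: power_int_prod)
  qed
  also have "\<dots> = (\<Prod>d\<in>Pi_set 0 n. H d) * (\<Prod>i = 1..card (Pi_set 1 n). (\<Prod>d\<in>Pi_set i n. H d) powi ((- 1) ^ i))"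
    by (simp add: prod.atLeast_Suc_atMost)
  also have "Pi_set 0 n = {1}"
  proof -
    have "{S. S \<subseteq> ?P \<and> card S = 0 \<and> \<Prod>S < n} = {{}}" using fin n by auto
    then show ?thesis by (simp add: Pi_set_eq)
  qed
  finally show ?thesis by simp
qed

text \<open>Moebius inversion restricted to odd divisors. The factors of \<open>F (n div s)\<close>, rewritten in terms of \<open>n\<close>, are
  the \<open>G (n div d)\<close> with \<open>s dvd d\<close>; inclusion-exclusion over the odd primes of \<open>n\<close> leaves those \<open>d\<close> that no odd
  prime of \<open>n\<close> divides, and \<open>d = 1\<close> is the only one.\<close>
lemma
  fixes F G :: "nat \<Rightarrow> 'a::field"
  assumes n: "n > 1"
    and F: "\<And>s. s dvd n \<Longrightarrow> odd s \<Longrightarrow> F (n div s) = (\<Prod>d | d dvd n div s \<and> odd d \<and> d < n div s. G (n div s div d))"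
    and G: "\<And>d. d dvd n \<Longrightarrow> G d \<noteq> 0"
  shows odd_divisor_inversion: "G n = (\<Prod>S\<in>Pow (odd_primes n). F (n div \<Prod>S) powi ((- 1) ^ card S))"
    and odd_divisor_inversion_quotient: "G n = F n / (\<Prod>d | 2 < d \<and> d < n \<and> d dvd n \<and> odd d. G (n div d))"
proof -
  let ?D = "{d. d dvd n \<and> odd d \<and> d < n}"
  let ?P = "odd_primes n"
  have finD: "finite ?D" by (rule finite_subset[of _ "{..n}"]) auto
  have finP: "finite ?P" using n by (intro finite_odd_primes) simp
  have Gd: "G (n div d) \<noteq> 0" if "d \<in> ?D" for d
    using that by (intro G) (auto simp: div_dvd_iff_mult)
  have shift: "F (n div s) = (\<Prod>d | d \<in> ?D \<and> s dvd d. G (n div d))" if s: "s dvd n" "odd s" for s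
  proof -
    have s0: "s > 0" using s(2) odd_pos by blast
    have "F (n div s) = (\<Prod>d | d dvd n div s \<and> odd d \<and> d < n div s. G (n div s div d))"
      using s by (rule F)
    also have "\<dots> = (\<Prod>d | d \<in> ?D \<and> s dvd d. G (n div d))"
    proof (rule prod.reindex_bij_witness[of _ "\<lambda>d. d div s" "\<lambda>d. s * d"])
      fix d assume "d \<in> {d. d dvd n div s \<and> odd d \<and> d < n div s}"
      then show "s * d div s = d" "s * d \<in> {d \<in> ?D. s dvd d}" "G (n div (s * d)) = G (n div s div d)"
        using s s0 by (auto simp: div_mult2_eq dvd_div_iff_mult less_mult_imp_div_less mult.commute elim!: dvdE)
    next
      fix d assume "d \<in> {d \<in> ?D. s dvd d}"
      then show "s * (d div s) = d" "d div s \<in> {d. d dvd n div s \<and> odd d \<and> d < n div s}"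
        using s s0 by (auto elim!: dvdE)
    qed
    finally show ?thesis .
  qed
  have "(\<Prod>S\<in>Pow ?P. F (n div \<Prod>S) powi ((- 1) ^ card S)) =
      (\<Prod>S\<in>Pow ?P. (\<Prod>d | d \<in> ?D \<and> (\<forall>p\<in>S. p dvd d). G (n div d)) powi ((- 1) ^ card S))"
  proof (rule prod.cong[OF refl])
    fix S assume S: "S \<in> Pow ?P"
    then have fin: "finite S" "\<And>p. p \<in> S \<Longrightarrow> prime p" using finP finite_subset by (auto simp: odd_primes_def)
    have "\<Prod>S dvd n" using S by (subst dvd_prod_primes_iff[OF fin]) (auto simp: odd_primes_def)
    moreover have "odd (\<Prod>S)" using S fin by (auto simp: even_prod_iff odd_primes_def)
    ultimately have "F (n div \<Prod>S) = (\<Prod>d | d \<in> ?D \<and> \<Prod>S dvd d. G (n div d))" by (rule shift)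
    then show "F (n div \<Prod>S) powi ((- 1) ^ card S) =
        (\<Prod>d | d \<in> ?D \<and> (\<forall>p\<in>S. p dvd d). G (n div d)) powi ((- 1) ^ card S)"
      by (simp only: dvd_prod_primes_iff[OF fin])
  qed
  also have "\<dots> = (\<Prod>d | d \<in> ?D \<and> (\<forall>p\<in>?P. \<not> p dvd d). G (n div d))"
    using finP finD Gd by (intro prod_inclusion_exclusion) auto
  also have "{d. d \<in> ?D \<and> (\<forall>p\<in>?P. \<not> p dvd d)} = {1}"
  proof -
    have "d = 1" if d: "d \<in> ?D" "\<forall>p\<in>?P. \<not> p dvd d" for d
    proof (rule ccontr)
      assume "d \<noteq> 1"
      then obtain p where p: "prime p" "p dvd d" using prime_factor_nat by blast
      then have "p \<in> ?P" using d(1) by (auto simp: odd_primes_def intro: dvd_trans)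
      then show False using d(2) p(2) by blast
    qed
    then show ?thesis using n by (auto simp: odd_primes_def)
  qed
  finally show "G n = (\<Prod>S\<in>Pow ?P. F (n div \<Prod>S) powi ((- 1) ^ card S))" by simp
  let ?E = "{d. 2 < d \<and> d < n \<and> d dvd n \<and> odd d}"
  have "F n = (\<Prod>d\<in>?D. G (n div d))" using shift[of 1] by simp
  also have "?D = insert 1 ?E"
  proof -
    have "d > 2" if "odd d" "d \<noteq> 1" for d :: nat using that by (cases d) (auto elim!: oddE)
    then show ?thesis using n by auto
  qed
  also have "(\<Prod>d\<in>\<dots>. G (n div d)) = G n * (\<Prod>d\<in>?E. G (n div d))"
    by (subst prod.insert) (auto intro: finite_subset[OF _ finD])
  finally have "F n = G n * (\<Prod>d\<in>?E. G (n div d))" .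
  moreover have "(\<Prod>d\<in>?E. G (n div d)) \<noteq> 0"
    using Gd finite_subset[OF _ finD, of ?E] by (subst prod_zero_iff) auto
  ultimately show "G n = F n / (\<Prod>d\<in>?E. G (n div d))" by simp
qed

section \<open>The minimal polynomials of twice the cosines\<close>

lemma odd_primes_prime_power:
  assumes "prime p" "odd p"
  shows "odd_primes (2 ^ j * p ^ l) = (if l = 0 then {} else {p})"
proof -
  have "q = p" if "prime q" "odd q" "q dvd 2 ^ j * p ^ l" for q
  proof -
    have "q dvd 2 ^ j \<or> q dvd p ^ l" using that prime_dvd_mult_iff by blast
    then have "q dvd 2 \<or> q dvd p" using that(1) prime_dvd_power by blast
    then show ?thesis using that assms primes_dvd_imp_eq two_is_prime_nat by metis
  qed
  moreover have "\<not> q dvd 2 ^ j" if "prime q" "odd q" for q :: nat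
    using that prime_dvd_power[of q 2 j] primes_dvd_imp_eq[of q 2] by auto
  ultimately show ?thesis using assms by (auto simp: odd_primes_def)
qed

text \<open>The common core of the three cases: \<open>X\<close> is one of \<open>p_minus\<close>, \<open>p_plus\<close>, \<open>q_minus\<close>, and \<open>N e\<close> is \<open>2 e\<close> or \<open>e\<close>.\<close>
lemma odd_divisor_inversion_cases:
  fixes X :: "nat \<Rightarrow> int poly" and N :: "nat \<Rightarrow> nat"
  assumes n: "n > 1" and N: "\<And>d. d > 0 \<Longrightarrow> N d > 0"
    and F: "\<And>s. s dvd n \<Longrightarrow> odd s \<Longrightarrow> int_to_ratfun (X (n div s div 2)) =
      (\<Prod>d | d dvd n div s \<and> odd d \<and> d < n div s. to_fract (psi (N (n div s div d))))"
  shows "to_fract (psi (N n)) = int_to_ratfun (X (n div 2)) /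
      (\<Prod>d | 2 < d \<and> d < n \<and> d dvd n \<and> odd d. to_fract (psi (N (n div d))))"
    and "to_fract (psi (N n)) = int_to_ratfun (X (n div 2)) *
      (\<Prod>i = 1..card (Pi_set 1 n).
        (\<Prod>d\<in>Pi_set i n. int_to_ratfun (X (n div (2 * d)))) powi ((- 1) ^ i))"
    and "odd_primes n = {} \<Longrightarrow> to_fract (psi (N n)) = int_to_ratfun (X (n div 2))"
    and "odd_primes n = {p} \<Longrightarrow>
      to_fract (psi (N n)) = int_to_ratfun (X (n div 2)) / int_to_ratfun (X (n div (2 * p)))"
proof -
  let ?F = "\<lambda>e. int_to_ratfun (X (e div 2))" and ?G = "\<lambda>e. to_fract (psi (N e))"
  have half: "n div d div 2 = n div (2 * d)" for d by (simp add: div_mult2_eq[symmetric] mult.commute)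
  have nz: "?G d \<noteq> 0" if "d dvd n" for d
  proof -
    have "lead_coeff (psi (N d)) = 1" using that n by (intro monic_psi N) (cases d; simp)
    then have "psi (N d) \<noteq> 0" by auto
    then show ?thesis by simp
  qed
  show "?G n = ?F n / (\<Prod>d | 2 < d \<and> d < n \<and> d dvd n \<and> odd d. ?G (n div d))"
    using n F nz by (rule odd_divisor_inversion_quotient)
  have inv: "?G n = (\<Prod>S\<in>Pow (odd_primes n). ?F (n div \<Prod>S) powi ((- 1) ^ card S))"
    using n F nz by (rule odd_divisor_inversion)
  also have "\<dots> = ?F (n div 1) * (\<Prod>i = 1..card (Pi_set 1 n). (\<Prod>d\<in>Pi_set i n. ?F (n div d)) powi ((- 1) ^ i))"
  proof (rule prod_Pow_odd_primes[OF n])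
    assume "odd n"
    have "{d. d dvd n div n \<and> odd d \<and> d < n div n} = {}" using n by auto
    with F[OF dvd_refl \<open>odd n\<close>] show "?F (n div n) = 1" by (simp only: prod.empty)
  qed
  finally show "?G n = ?F n * (\<Prod>i = 1..card (Pi_set 1 n).
      (\<Prod>d\<in>Pi_set i n. int_to_ratfun (X (n div (2 * d)))) powi ((- 1) ^ i))"
    by (simp only: half div_by_1)
  show "?G n = ?F n" if "odd_primes n = {}"
    using inv that by simp
  show "?G n = ?F n / int_to_ratfun (X (n div (2 * p)))" if "odd_primes n = {p}"
    using inv that by (simp add: Pow_insert half divide_inverse power_int_minus)
qed


lemma psi_frac_odd:
  assumes "n > 0" "odd m" "coprime m n"
  shows "psi_frac m n = psi (2 * n)"
  using min_poly_two_cos[of "2 * n" m] assms by (simp add: psi_frac_def mult_ac)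

lemma psi_frac_even:
  assumes "n > 0" "even m" "coprime m n"
  shows "psi_frac m n = psi n"
  using min_poly_two_cos[of n "m div 2"] assms by (auto simp: psi_frac_def mult_ac elim!: evenE)

theorem theorem1p4:
  fixes m n :: nat
  assumes "n > 2" and "0 < m" and "m < n" and "coprime m n"
  shows
    "(odd n \<and> odd m \<longrightarrow>
        psi_frac m n = psi_frac 1 n \<and>
        psi_frac 1 n = psi (2 * n) \<and>
        to_fract (psi (2 * n)) =
          int_to_ratfun (p_minus (n div 2)) /
            (\<Prod>d | 2 < d \<and> d < n \<and> d dvd n. to_fract (psi (2 * n div d))) \<and>
        to_fract (psi (2 * n)) =
          int_to_ratfun (p_minus (n div 2)) *
            (\<Prod>i = 1..card (Pi_set 1 n).
              (\<Prod>d\<in>Pi_set i n. int_to_ratfun (p_minus (n div (2 * d)))) powi ((- 1) ^ i)) \<and>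
        (\<forall>p l. prime p \<and> odd p \<and> n = p ^ l \<longrightarrow>
          (l = 1 \<longrightarrow>
            to_fract (psi_frac m n) = int_to_ratfun (p_minus (n div 2))) \<and>
          (l > 1 \<longrightarrow>
            to_fract (psi_frac m n) =
              int_to_ratfun (p_minus (n div 2)) / int_to_ratfun (p_minus (n div (2 * p))))))
     \<and>
     (odd n \<and> even m \<longrightarrow>
        psi_frac m n = psi_frac 2 n \<and>
        psi_frac 2 n = psi n \<and>
        to_fract (psi n) =
          int_to_ratfun (p_plus (n div 2)) /
            (\<Prod>d | 2 < d \<and> d < n \<and> d dvd n. to_fract (psi (n div d))) \<and>
        to_fract (psi n) =
          int_to_ratfun (p_plus (n div 2)) *
            (\<Prod>i = 1..card (Pi_set 1 n).
              (\<Prod>d\<in>Pi_set i n. int_to_ratfun (p_plus (n div (2 * d)))) powi ((- 1) ^ i)) \<and>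
        (\<forall>p l. prime p \<and> odd p \<and> n = p ^ l \<longrightarrow>
          (l = 1 \<longrightarrow>
            to_fract (psi_frac m n) = int_to_ratfun (p_plus (n div 2))) \<and>
          (l > 1 \<longrightarrow>
            to_fract (psi_frac m n) =
              int_to_ratfun (p_plus (n div 2)) / int_to_ratfun (p_plus (n div (2 * p))))))
     \<and>
     (\<forall>j n'. n = 2 ^ j * n' \<and> j > 0 \<and> odd n' \<and> odd m \<longrightarrow>
        psi_frac m n = psi_frac 1 n \<and>
        psi_frac 1 n = psi (2 * n) \<and>
        to_fract (psi (2 * n)) =
          int_to_ratfun (q_minus (n div 2)) /
            (\<Prod>d | 2 < d \<and> d \<le> n' \<and> d dvd n'. to_fract (psi (2 * n div d))) \<and>
        to_fract (psi (2 * n)) =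
          int_to_ratfun (q_minus (n div 2)) *
            (\<Prod>i = 1..card (Pi_set 1 n).
              (\<Prod>d\<in>Pi_set i n. int_to_ratfun (q_minus (n div (2 * d)))) powi ((- 1) ^ i)) \<and>
        (\<forall>p l. prime p \<and> odd p \<and> n = 2 ^ j * p ^ l \<longrightarrow>
          (l = 0 \<longrightarrow>
            to_fract (psi_frac m n) = int_to_ratfun (q_minus (n div 2))) \<and>
          (l > 0 \<longrightarrow>
            to_fract (psi_frac m n) =
              int_to_ratfun (q_minus (n div 2)) / int_to_ratfun (q_minus (n div (2 * p))))))"
proof (intro conjI impI)
  assume "odd n \<and> odd m"
  then have n: "odd n" and m: "odd m" by auto
  have psi_m: "psi_frac m n = psi (2 * n)" using assms m by (intro psi_frac_odd) auto
  show psi_1: "psi_frac 1 n = psi (2 * n)" using assms by (intro psi_frac_odd) auto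
  with psi_m show "psi_frac m n = psi_frac 1 n" by simp
  have prod: "int_to_ratfun (p_minus (n div s div 2)) =
      (\<Prod>d | d dvd n div s \<and> odd d \<and> d < n div s. to_fract (psi (2 * (n div s div d))))"
    if "s dvd n" for s
    using that n by (intro p_minus_eq_prod_psi) (metis dvd_div_mult_self even_mult_iff)
  note inversion = odd_divisor_inversion_cases[of n "\<lambda>e. 2 * e" p_minus, OF _ _ prod]
  have "{d. 2 < d \<and> d < n \<and> d dvd n} = {d. 2 < d \<and> d < n \<and> d dvd n \<and> odd d}"
    using n by (auto dest: dvd_trans)
  then show "to_fract (psi (2 * n)) = int_to_ratfun (p_minus (n div 2)) /
      (\<Prod>d | 2 < d \<and> d < n \<and> d dvd n. to_fract (psi (2 * n div d)))"
    using inversion(1) assms(1) by (simp add: div_mult_swap)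
  show "to_fract (psi (2 * n)) = int_to_ratfun (p_minus (n div 2)) *
      (\<Prod>i = 1..card (Pi_set 1 n).
        (\<Prod>d\<in>Pi_set i n. int_to_ratfun (p_minus (n div (2 * d)))) powi ((- 1) ^ i))"
    using inversion(2) assms(1) by simp
  show "\<forall>p l. prime p \<and> odd p \<and> n = p ^ l \<longrightarrow>
      (l = 1 \<longrightarrow> to_fract (psi_frac m n) = int_to_ratfun (p_minus (n div 2))) \<and>
      (l > 1 \<longrightarrow> to_fract (psi_frac m n) =
        int_to_ratfun (p_minus (n div 2)) / int_to_ratfun (p_minus (n div (2 * p))))"
  proof (intro allI impI)
    fix p l assume p: "prime p \<and> odd p \<and> n = p ^ l"
    then have "l \<noteq> 0" using assms(1) by (intro notI) simp
    then have "odd_primes n = {p}" using odd_primes_prime_power[of p 0 l] p by simp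
    then have "to_fract (psi_frac m n) =
        int_to_ratfun (p_minus (n div 2)) / int_to_ratfun (p_minus (n div (2 * p)))"
      using inversion(4) assms(1) psi_m by simp
    \<comment> \<open>For \<open>n = p\<close> the denominator is \<open>p_minus 0 = 1\<close>.\<close>
    moreover have "int_to_ratfun (p_minus (n div (2 * p))) = 1" if "l = 1"
      using p that prime_gt_0_nat[of p] by (simp add: p_minus_0 int_to_ratfun_def)
    ultimately show "(l = 1 \<longrightarrow> to_fract (psi_frac m n) = int_to_ratfun (p_minus (n div 2))) \<and>
        (l > 1 \<longrightarrow> to_fract (psi_frac m n) =
          int_to_ratfun (p_minus (n div 2)) / int_to_ratfun (p_minus (n div (2 * p))))"
      by simp
  qed
next
  assume "odd n \<and> even m"
  then have n: "odd n" and m: "even m" by auto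
  have psi_m: "psi_frac m n = psi n" using assms m by (intro psi_frac_even) auto
  show psi_2: "psi_frac 2 n = psi n" using assms n by (intro psi_frac_even) auto
  with psi_m show "psi_frac m n = psi_frac 2 n" by simp
  have prod: "int_to_ratfun (p_plus (n div s div 2)) =
      (\<Prod>d | d dvd n div s \<and> odd d \<and> d < n div s. to_fract (psi (n div s div d)))"
    if "s dvd n" for s
    using that n by (intro p_plus_eq_prod_psi) (metis dvd_div_mult_self even_mult_iff)
  note inversion = odd_divisor_inversion_cases[of n "\<lambda>e. e" p_plus, OF _ _ prod]
  have "{d. 2 < d \<and> d < n \<and> d dvd n} = {d. 2 < d \<and> d < n \<and> d dvd n \<and> odd d}"
    using n by (auto dest: dvd_trans)
  then show "to_fract (psi n) = int_to_ratfun (p_plus (n div 2)) /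
      (\<Prod>d | 2 < d \<and> d < n \<and> d dvd n. to_fract (psi (n div d)))"
    using inversion(1) assms(1) by (simp add: div_mult_swap)
  show "to_fract (psi n) = int_to_ratfun (p_plus (n div 2)) *
      (\<Prod>i = 1..card (Pi_set 1 n).
        (\<Prod>d\<in>Pi_set i n. int_to_ratfun (p_plus (n div (2 * d)))) powi ((- 1) ^ i))"
    using inversion(2) assms(1) by simp
  show "\<forall>p l. prime p \<and> odd p \<and> n = p ^ l \<longrightarrow>
      (l = 1 \<longrightarrow> to_fract (psi_frac m n) = int_to_ratfun (p_plus (n div 2))) \<and>
      (l > 1 \<longrightarrow> to_fract (psi_frac m n) =
        int_to_ratfun (p_plus (n div 2)) / int_to_ratfun (p_plus (n div (2 * p))))"
  proof (intro allI impI)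
    fix p l assume p: "prime p \<and> odd p \<and> n = p ^ l"
    then have "l \<noteq> 0" using assms(1) by (intro notI) simp
    then have "odd_primes n = {p}" using odd_primes_prime_power[of p 0 l] p by simp
    then have "to_fract (psi_frac m n) =
        int_to_ratfun (p_plus (n div 2)) / int_to_ratfun (p_plus (n div (2 * p)))"
      using inversion(4) assms(1) psi_m by simp
    \<comment> \<open>For \<open>n = p\<close> the denominator is \<open>p_plus 0 = 1\<close>.\<close>
    moreover have "int_to_ratfun (p_plus (n div (2 * p))) = 1" if "l = 1"
      using p that prime_gt_0_nat[of p] by (simp add: p_plus_0 int_to_ratfun_def)
    ultimately show "(l = 1 \<longrightarrow> to_fract (psi_frac m n) = int_to_ratfun (p_plus (n div 2))) \<and>
        (l > 1 \<longrightarrow> to_fract (psi_frac m n) =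
          int_to_ratfun (p_plus (n div 2)) / int_to_ratfun (p_plus (n div (2 * p))))"
      by simp
  qed
next
  show "\<forall>j n'. n = 2 ^ j * n' \<and> j > 0 \<and> odd n' \<and> odd m \<longrightarrow>
        psi_frac m n = psi_frac 1 n \<and>
        psi_frac 1 n = psi (2 * n) \<and>
        to_fract (psi (2 * n)) =
          int_to_ratfun (q_minus (n div 2)) /
            (\<Prod>d | 2 < d \<and> d \<le> n' \<and> d dvd n'. to_fract (psi (2 * n div d))) \<and>
        to_fract (psi (2 * n)) =
          int_to_ratfun (q_minus (n div 2)) *
            (\<Prod>i = 1..card (Pi_set 1 n).
              (\<Prod>d\<in>Pi_set i n. int_to_ratfun (q_minus (n div (2 * d)))) powi ((- 1) ^ i)) \<and>
        (\<forall>p l. prime p \<and> odd p \<and> n = 2 ^ j * p ^ l \<longrightarrow>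
          (l = 0 \<longrightarrow>
            to_fract (psi_frac m n) = int_to_ratfun (q_minus (n div 2))) \<and>
          (l > 0 \<longrightarrow>
            to_fract (psi_frac m n) =
              int_to_ratfun (q_minus (n div 2)) / int_to_ratfun (q_minus (n div (2 * p)))))"
  proof (intro allI impI, elim conjE, intro conjI allI impI)
    fix j n'
    assume n: "n = 2 ^ j * n'" and j: "j > 0" and n': "odd n'" and m: "odd m"
    have even: "even n" using n j by simp
    have psi_m: "psi_frac m n = psi (2 * n)" using assms m by (intro psi_frac_odd) auto
    show psi_1: "psi_frac 1 n = psi (2 * n)" using assms by (intro psi_frac_odd) auto
    with psi_m show "psi_frac m n = psi_frac 1 n" by simp
    have prod: "int_to_ratfun (q_minus (n div s div 2)) =
        (\<Prod>d | d dvd n div s \<and> odd d \<and> d < n div s. to_fract (psi (2 * (n div s div d))))"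
      if s: "s dvd n" "odd s" for s
    proof (rule q_minus_eq_prod_psi)
      have "n = s * (n div s)" using s by simp
      then show "even (n div s)" "n div s > 0" using even s(2) assms(1)
        by (metis even_mult_iff, metis gr0I mult_0_right not_less_zero)
    qed
    note inversion = odd_divisor_inversion_cases[of n "\<lambda>e. 2 * e" q_minus, OF _ _ prod]
    have "{d. 2 < d \<and> d \<le> n' \<and> d dvd n'} = {d. 2 < d \<and> d < n \<and> d dvd n \<and> odd d}"
    proof (intro Collect_cong iffI; elim conjE; intro conjI)
      fix d assume "d dvd n'"
      then show "odd d" "d dvd n" using n n' by (auto dest: dvd_trans)
      then show "d < n" using even assms(1) by (metis dvd_imp_le gr_implies_not0 le_neq_implies_less not_gr0)
    next
      fix d assume "d dvd n" "odd d"
      then show "d dvd n'" unfolding n by (simp add: coprime_dvd_mult_right_iff)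
      then show "d \<le> n'" using n' by (intro dvd_imp_le) (auto intro: odd_pos)
    qed
    then show "to_fract (psi (2 * n)) = int_to_ratfun (q_minus (n div 2)) /
        (\<Prod>d | 2 < d \<and> d \<le> n' \<and> d dvd n'. to_fract (psi (2 * n div d)))"
      using inversion(1) assms(1) by (simp add: div_mult_swap)
    show "to_fract (psi (2 * n)) = int_to_ratfun (q_minus (n div 2)) *
        (\<Prod>i = 1..card (Pi_set 1 n).
          (\<Prod>d\<in>Pi_set i n. int_to_ratfun (q_minus (n div (2 * d)))) powi ((- 1) ^ i))"
      using inversion(2) assms(1) by simp
    fix p l assume "prime p \<and> odd p \<and> n = 2 ^ j * p ^ l"
    then have P: "odd_primes n = (if l = 0 then {} else {p})"
      by (simp add: odd_primes_prime_power)
    show "to_fract (psi_frac m n) = int_to_ratfun (q_minus (n div 2))" if "l = 0"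
      using inversion(3) P that assms(1) psi_m by simp
    show "to_fract (psi_frac m n) =
        int_to_ratfun (q_minus (n div 2)) / int_to_ratfun (q_minus (n div (2 * p)))" if "l > 0"
      using inversion(4) P that assms(1) psi_m by simp
  qed
qed

end
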